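(* We have $\omega^4 < R^{cl}(\omega \cdot 2+1,3)<\omega^5$, and for every integer $n \geq 3$ we have $\omega^4 \cdot (n-2)+1 < R^{cl}(\omega \cdot n+1,3)<\omega^5$.
   Context: Ordinals carry their order topology. For ordinals $\alpha,\beta$ and a subset $X \subseteq \alpha$ with the subspace topology, $X$ is a closed copy of $\beta$ if there is a map $f: X \to \beta$ which is both an order-isomorphism and a homeomorphism. For a set $X$, $[X]^2$ denotes the set of two-element subsets of $X$. For ordinals $\alpha,\beta,\gamma$, write $\gamma \rightarrow_{cl} (\alpha,\beta)^2$ if for every function $\mathfrak{c}:[\gamma]^2 \to \{0,1\}$ there is $X \subseteq \gamma$ such that either $X$ is a closed copy of $\alpha$ and $\mathfrak{c}$ takes value $0$ on all of $[X]^2$, or $X$ is a closed copy of $\beta$ and $\mathfrak{c}$ takes value $1$ on all of $[X]^2$. The closed Ramsey number $R^{cl}(\alpha,\beta)$ is the least ordinal $\gamma$ with $\gamma \rightarrow_{cl} (\alpha,\beta)^2$. Here $3$ denotes the ordinal $\{0,1,2\}$. *)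

theory Defs
  imports "HOL-Analysis.Analysis" "HOL-Library.Ramsey"
begin

unbundle cardinal_syntax

section \<open>Countable ordinals\<close>

text \<open>The type \<open>cord\<close> is the ordinal \<open>\<omega>\<^sub>1\<close>, that is, the well-order of all countable ordinals.
  As usual an ordinal \<open>\<alpha>\<close> is identified with the set \<open>{..<\<alpha>}\<close> of smaller ordinals.\<close>

lemma Card_order_omega1: "Card_order (cardSuc natLeq)"
  by (simp add: cardSuc_Card_order natLeq_Card_order)

lemma Well_order_omega1: "Well_order (cardSuc natLeq)"
  using Card_order_omega1 card_order_on_well_order_on by blast

typedef cord = "Field (cardSuc natLeq)"
  using Field_cardSuc_not_empty[OF natLeq_Card_order] by blast

setup_lifting type_definition_cord

instantiation cord :: linorder
begin

lift_definition less_eq_cord :: "cord \<Rightarrow> cord \<Rightarrow> bool"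
  is "\<lambda>x y. (x, y) \<in> cardSuc natLeq" .

definition less_cord :: "cord \<Rightarrow> cord \<Rightarrow> bool"
  where "less_cord x y \<longleftrightarrow> x \<le> y \<and> \<not> y \<le> x"

instance
proof
  note wo = Well_order_omega1[unfolded well_order_on_def linear_order_on_def
      partial_order_on_def preorder_on_def]
  fix x y z :: cord
  show "x < y \<longleftrightarrow> x \<le> y \<and> \<not> y \<le> x" by (rule less_cord_def)
  show "x \<le> x" using wo by transfer (auto simp: refl_on_def)
  show "x \<le> y \<Longrightarrow> y \<le> z \<Longrightarrow> x \<le> z" using wo by transfer (metis transD)
  show "x \<le> y \<Longrightarrow> y \<le> x \<Longrightarrow> x = y" using wo by transfer (metis antisymD)
  show "x \<le> y \<or> y \<le> x" using wo by transfer (metis refl_onD total_on_def)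
qed

end

lemma less_cord_iff: "x < y \<longleftrightarrow> (Rep_cord x, Rep_cord y) \<in> cardSuc natLeq - Id"
  for x y :: cord
  by (auto simp: less_le less_eq_cord.rep_eq Rep_cord_inject)

instance cord :: wellorder
proof
  fix P :: "cord \<Rightarrow> bool" and a :: cord
  assume step: "\<And>x. (\<And>y. y < x \<Longrightarrow> P y) \<Longrightarrow> P x"
  have "wf (cardSuc natLeq - Id)"
    using Well_order_omega1 unfolding well_order_on_def by blast
  then have "wf (inv_image (cardSuc natLeq - Id) Rep_cord)"
    by (rule wf_inv_image)
  then show "P a"
  proof (induction a rule: wf_induct_rule)
    case (less x)
    show ?case by (rule step, rule less) (simp add: less_cord_iff)
  qed
qed

instantiation cord :: linorder_topology
begin

definition open_cord :: "cord set \<Rightarrow> bool"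
  where "open_cord = generate_topology (range (\<lambda>a. {..<a}) \<union> range (\<lambda>a. {a<..}))"

instance by standard (rule open_cord_def)

end

lemma underS_Rep_cord: "underS (cardSuc natLeq) (Rep_cord a) = Rep_cord ` {..<a}"
proof
  show "underS (cardSuc natLeq) (Rep_cord a) \<subseteq> Rep_cord ` {..<a}"
  proof
    fix y assume y: "y \<in> underS (cardSuc natLeq) (Rep_cord a)"
    then have "y \<in> Field (cardSuc natLeq)" by (auto simp: underS_def Field_def)
    then obtain b where "y = Rep_cord b" by (metis Rep_cord_cases)
    with y show "y \<in> Rep_cord ` {..<a}" by (auto simp: underS_def less_cord_iff)
  qed
qed (auto simp: underS_def less_cord_iff)

lemma countable_iff_le_natLeq: "countable A \<longleftrightarrow> |A| \<le>o natLeq"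
proof -
  have "countable A \<longleftrightarrow> |A| \<le>o |UNIV :: nat set|"
    unfolding card_of_ordLeq[symmetric] countable_def by auto
  also have "\<dots> \<longleftrightarrow> |A| \<le>o natLeq"
    using card_of_nat ordIso_symmetric ordLeq_ordIso_trans by blast
  finally show ?thesis .
qed

lemma countable_lessThan_cord: "countable {..<a :: cord}"
proof -
  have "|underS (cardSuc natLeq) (Rep_cord a)| <o cardSuc natLeq"
    by (rule card_of_underS[OF Card_order_omega1 Rep_cord])
  then have "countable (Rep_cord ` {..<a})"
    unfolding underS_Rep_cord countable_iff_le_natLeq
    by (simp add: cardSuc_ordLeq_ordLess card_of_Card_order natLeq_Card_order)
  then show ?thesis
    by (rule countable_image_inj_on) (simp add: inj_on_def Rep_cord_inject)
qed

lemma uncountable_cord: "\<not> countable (UNIV :: cord set)"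
proof
  assume "countable (UNIV :: cord set)"
  then have "countable (range Rep_cord)" by (rule countable_image)
  moreover have "range Rep_cord = Field (cardSuc natLeq)"
    using type_definition.Rep_range[OF type_definition_cord] .
  ultimately have "|Field (cardSuc natLeq)| \<le>o natLeq"
    by (simp add: countable_iff_le_natLeq)
  then have "cardSuc natLeq \<le>o natLeq"
    using card_of_Field_ordIso[OF Card_order_omega1] ordIso_symmetric ordIso_ordLeq_trans by blast
  then show False
    using cardSuc_greater[OF natLeq_Card_order] not_ordLess_ordLeq by blast
qed

lemma cord_countable_bounded:
  assumes "countable (A :: cord set)"
  shows "\<exists>b. \<forall>a\<in>A. a < b"
proof (rule ccontr)
  assume "\<not> ?thesis"
  then have "UNIV = (\<Union>a\<in>A. {..a})" by (force simp: not_less)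
  moreover have "countable {..a :: cord}" for a
  proof -
    have "{..a} = insert a {..<a}" by auto
    then show ?thesis using countable_lessThan_cord by simp
  qed
  ultimately show False using assms uncountable_cord by (metis countable_UN)
qed

lemma cord_realizes_countable_Well_order:
  assumes "Well_order r" "countable (Field r)"
  shows "\<exists>(a :: cord) f. bij_betw f (Field r) {..<a} \<and>
           (\<forall>x\<in>Field r. \<forall>y\<in>Field r. (x, y) \<in> r \<longleftrightarrow> f x \<le> f y)"
proof -
  let ?w = "cardSuc natLeq"
  have "\<not> ?w \<le>o r"
  proof
    assume "?w \<le>o r"
    then have "|Field ?w| \<le>o |Field r|" by (rule card_of_mono2)
    also have "|Field r| \<le>o natLeq" using assms(2) by (simp add: countable_iff_le_natLeq)
    finally have "?w \<le>o natLeq"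
      using card_of_Field_ordIso[OF Card_order_omega1] ordIso_symmetric ordIso_ordLeq_trans by blast
    then show False
      using cardSuc_greater[OF natLeq_Card_order] not_ordLess_ordLeq by blast
  qed
  then have "r <o ?w"
    using assms(1) Well_order_omega1 not_ordLeq_iff_ordLess by blast
  then obtain x where x: "x \<in> Field ?w" "r =o Restr ?w (underS ?w x)"
    using ordLess_iff_ordIso_Restr assms(1) Well_order_omega1 by blast
  then obtain a where a: "x = Rep_cord a" by (metis Rep_cord_cases)
  obtain f where f: "iso r (Restr ?w (underS ?w x)) f"
    using x(2) unfolding ordIso_def by blast
  have "Field (Restr ?w (underS ?w x)) = underS ?w x"
    using Well_order_omega1
    by (metis Refl_Field_Restr2 underS_Field subsetI wo_rel.REFL wo_rel_def)
  then have bij: "bij_betw f (Field r) (Rep_cord ` {..<a})"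
    using f by (simp add: iso_def underS_Rep_cord a)
  then have mem: "\<And>u. u \<in> Field r \<Longrightarrow> f u \<in> Rep_cord ` {..<a}"
    by (auto simp: bij_betw_def)
  have ord: "(u, v) \<in> r \<longleftrightarrow> (f u, f v) \<in> ?w" if "u \<in> Field r" "v \<in> Field r" for u v
    using f assms(1) that mem Well_order_Restr[OF Well_order_omega1]
    by (subst (asm) iso_iff2) (auto simp: underS_Rep_cord a)
  show ?thesis
  proof (intro exI conjI ballI)
    have "bij_betw Abs_cord (Rep_cord ` {..<a}) {..<a}"
      by (rule bij_betw_byWitness[where f' = Rep_cord]) (auto simp: Rep_cord_inverse)
    with bij show "bij_betw (Abs_cord \<circ> f) (Field r) {..<a}"
      by (rule bij_betw_trans)
    fix u v assume uv: "u \<in> Field r" "v \<in> Field r"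
    then show "(u, v) \<in> r \<longleftrightarrow> (Abs_cord \<circ> f) u \<le> (Abs_cord \<circ> f) v"
      using ord[OF uv] mem[OF uv(1)] mem[OF uv(2)]
      by (auto simp: less_eq_cord.rep_eq Rep_cord_inverse)
  qed
qed

unbundle no cardinal_syntax

text \<open>Since \<open>{..<\<gamma>}\<close> is an initial segment, its order topology is the subspace topology
  inherited from \<open>cord\<close>.\<close>

lemma order_topology_lessThan_cord:
  fixes c :: cord
  shows "top_of_set {..<c} = topology_generated_by
    ({{..<c}} \<union> (\<lambda>a. {x \<in> {..<c}. x < a}) ` {..<c} \<union> (\<lambda>a. {x \<in> {..<c}. a < x}) ` {..<c})"
    (is "_ = ?T")
proof -
  let ?B = "{{..<c}} \<union> (\<lambda>a. {x \<in> {..<c}. x < a}) ` {..<c} \<union> (\<lambda>a. {x \<in> {..<c}. a < x}) ` {..<c}"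
  have C: "openin ?T {..<c}" by (rule topology_generated_by_Basis) simp
  have O: "openin ?T (U \<inter> {..<c})" if "open U" for U
    using that unfolding open_generated_order
  proof (induction rule: generate_topology.induct)
    case UNIV
    show ?case using C by simp
  next
    case (Int a b)
    have "openin ?T ((a \<inter> {..<c}) \<inter> (b \<inter> {..<c}))" by (rule openin_Int[OF Int.IH])
    moreover have "(a \<inter> {..<c}) \<inter> (b \<inter> {..<c}) = a \<inter> b \<inter> {..<c}" by blast
    ultimately show ?case by simp
  next
    case (UN K)
    have "openin ?T (\<Union>k\<in>K. k \<inter> {..<c})" using UN.IH by (intro openin_Union) blast
    moreover have "(\<Union>k\<in>K. k \<inter> {..<c}) = \<Union>K \<inter> {..<c}" by blast
    ultimately show ?case by simp
  next
    case (Basis s)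
    then consider a where "s = {..<a}" | a where "s = {a<..}" by blast
    then show ?case
    proof cases
      case (1 a)
      show ?thesis
      proof (cases "a < c")
        case True
        then have "s \<inter> {..<c} \<in> ?B" using 1 by auto
        then show ?thesis by (rule topology_generated_by_Basis)
      next
        case False
        then have "s \<inter> {..<c} = {..<c}" using 1 by auto
        then show ?thesis using C by simp
      qed
    next
      case (2 a)
      show ?thesis
      proof (cases "a < c")
        case True
        then have "s \<inter> {..<c} \<in> ?B" using 2 by auto
        then show ?thesis by (rule topology_generated_by_Basis)
      next
        case False
        then have "s \<inter> {..<c} = {}" using 2 by auto
        then show ?thesis by simp
      qed
    qed
  qed
  have *: "openin ?T U" if "open U" "U \<subseteq> {..<c}" for U
    using O[OF that(1)] unfolding Int_absorb2[OF that(2)] .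
  have **: "U \<subseteq> {..<c}" if "openin ?T U" for U
  proof -
    have "\<Union>?B \<subseteq> {..<c}" by (intro Union_least) blast
    then show ?thesis
      using openin_subset[OF that] unfolding topology_generated_by_topspace by (rule order_trans[rotated])
  qed
  have ***: "open U" if "openin ?T U" for U
  proof -
    have "generate_topology_on ?B U" using that by (simp add: openin_topology_generated_by_iff)
    then show ?thesis
    proof (induction rule: generate_topology_on.induct)
      case (Basis s)
      then consider a where "s = {..<c} \<inter> {..<a}" | a where "s = {..<c} \<inter> {a<..}" | "s = {..<c}"
        unfolding lessThan_def greaterThan_def by blast
      then show ?case by cases (simp_all add: open_Int)
    qed (simp_all add: open_Int open_Union)
  qed
  show ?thesis
    unfolding topology_eq openin_open_eq[OF open_lessThan]
    by (intro allI iffI conjI) (erule conjE, erule (1) *, erule ***, erule **)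
qed

section \<open>Ordinal arithmetic\<close>

text \<open>Sums and products are defined by the recursions
  \<open>\<alpha> + \<beta> = sup ({\<alpha>} \<union> {(\<alpha> + \<delta>) + 1 | \<delta> < \<beta>})\<close> and \<open>\<alpha> * \<beta> = sup {\<alpha> * \<delta> + \<alpha> | \<delta> < \<beta>}\<close>,
  equivalent to the customary ones by cases on zero, successors and limits.\<close>

function add_cord :: "cord \<Rightarrow> cord \<Rightarrow> cord" where
  "add_cord a b = (LEAST c. a \<le> c \<and> (\<forall>d. d < b \<longrightarrow> add_cord a d < c))"
  by auto
termination
  by (relation "inv_image {(x, y). x < y} snd") (auto intro: wf)

declare add_cord.simps [simp del]

instantiation cord :: "{zero, one, plus}"
begin

definition zero_cord :: cord where "0 = (LEAST a :: cord. True)"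
definition one_cord :: cord where "1 = (LEAST a :: cord. 0 < a)"
definition plus_cord :: "cord \<Rightarrow> cord \<Rightarrow> cord" where "plus_cord = add_cord"

instance ..

end

lemma plus_cord_eq: "a + b = (LEAST c. a \<le> c \<and> (\<forall>d<b. a + d < c))" for a b :: cord
  unfolding plus_cord_def by (subst add_cord.simps) simp

lemma zero_le_cord [simp]: "0 \<le> (a :: cord)"
  by (simp add: zero_cord_def Least_le)

lemma plus_cord_bound: "a \<le> a + b \<and> (\<forall>d<b. a + d < a + b)" for a b :: cord
proof -
  have "countable (insert a ((\<lambda>d. a + d) ` {..<b}))"
    by (simp add: countable_lessThan_cord)
  then obtain c where "\<forall>x\<in>insert a ((\<lambda>d. a + d) ` {..<b}). x < c"
    using cord_countable_bounded by blast
  then have "a \<le> c \<and> (\<forall>d<b. a + d < c)" by auto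
  then show ?thesis by (subst (1 3) plus_cord_eq) (rule LeastI)
qed

lemma le_plus_cord: "a \<le> a + b" for a b :: cord
  using plus_cord_bound by blast

lemma plus_cord_strict_mono: "d < b \<Longrightarrow> a + d < a + b" for a b d :: cord
  using plus_cord_bound by blast

lemma plus_cord_mono: "d \<le> b \<Longrightarrow> a + d \<le> a + b" for a b d :: cord
  using plus_cord_strict_mono[of d b a] by (auto simp: le_less)

lemma plus_cord_least: "a \<le> c \<Longrightarrow> (\<And>d. d < b \<Longrightarrow> a + d < c) \<Longrightarrow> a + b \<le> c" for a b c :: cord
  by (subst plus_cord_eq) (auto intro: Least_le)

lemma less_plus_cordE:
  fixes e a b :: cord
  assumes "e < a + b"
  obtains "e < a" | d where "d < b" "e \<le> a + d"
  using assms plus_cord_least[of a e b] by (meson not_less not_le)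

lemma plus_cord_right_mono: "a \<le> b \<Longrightarrow> a + c \<le> b + c" for a b c :: cord
proof (induction c rule: less_induct)
  case (less c)
  show ?case
  proof (rule plus_cord_least)
    show "a \<le> b + c" using less.prems le_plus_cord order_trans by blast
    show "a + d < b + c" if "d < c" for d
      using less.IH[OF that less.prems] plus_cord_strict_mono[OF that, of b] by (rule le_less_trans)
  qed
qed

instance cord :: monoid_add
proof
  fix a b c :: cord
  show "0 + a = a"
  proof (induction a rule: less_induct)
    case (less a)
    show ?case
    proof (rule antisym)
      show "0 + a \<le> a" by (rule plus_cord_least) (simp_all add: less)
      show "a \<le> 0 + a"
        by (metis less less_irrefl not_le plus_cord_strict_mono)
    qed
  qed
  show "a + 0 = a"
    by (rule antisym[OF plus_cord_least le_plus_cord]) (auto simp: not_le[symmetric])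
  show "a + b + c = a + (b + c)"
  proof (induction c rule: less_induct)
    case (less c)
    show ?case
    proof (rule antisym)
      show "a + b + c \<le> a + (b + c)"
      proof (rule plus_cord_least)
        show "a + b \<le> a + (b + c)" by (rule plus_cord_mono[OF le_plus_cord])
        show "a + b + d < a + (b + c)" if "d < c" for d
          unfolding less[OF that] by (intro plus_cord_strict_mono that)
      qed
      show "a + (b + c) \<le> a + b + c"
      proof (rule plus_cord_least)
        show "a \<le> a + b + c" using le_plus_cord order_trans by blast
        fix e assume "e < b + c"
        then show "a + e < a + b + c"
        proof (cases rule: less_plus_cordE)
          case 1
          then show ?thesis using plus_cord_strict_mono le_plus_cord less_le_trans by blast
        next
          case (2 d)
          have "a + e \<le> a + (b + d)" by (rule plus_cord_mono[OF 2(2)])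
          also have "\<dots> = a + b + d" using less[OF 2(1)] by simp
          also have "\<dots> < a + b + c" by (rule plus_cord_strict_mono[OF 2(1)])
          finally show ?thesis .
        qed
      qed
    qed
  qed
qed

lemma less_one_cord_iff: "a < 1 \<longleftrightarrow> a = 0" for a :: cord
proof -
  obtain b :: cord where "0 < b" using cord_countable_bounded[of "{0}"] by auto
  then have "(0 :: cord) < 1" unfolding one_cord_def by (rule LeastI)
  moreover have "\<not> 0 < a" if "a < 1"
    using that unfolding one_cord_def by (rule not_less_Least)
  ultimately show ?thesis by (auto simp: not_less antisym)
qed

lemma plus_one_le_cord_iff: "a + 1 \<le> b \<longleftrightarrow> a < b" for a b :: cord
proof
  assume "a + 1 \<le> b"
  moreover have "a + 0 < a + 1" by (rule plus_cord_strict_mono) (simp add: less_one_cord_iff)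
  ultimately show "a < b" by simp
next
  assume "a < b"
  then show "a + 1 \<le> b" by (intro plus_cord_least) (auto simp: less_one_cord_iff)
qed

function mult_cord :: "cord \<Rightarrow> cord \<Rightarrow> cord" where
  "mult_cord a b = (LEAST c. \<forall>d. d < b \<longrightarrow> mult_cord a d + a \<le> c)"
  by auto
termination
  by (relation "inv_image {(x, y). x < y} snd") (auto intro: wf)

declare mult_cord.simps [simp del]

instantiation cord :: times
begin

definition times_cord :: "cord \<Rightarrow> cord \<Rightarrow> cord" where "times_cord = mult_cord"

instance ..

end

lemma times_cord_eq: "a * b = (LEAST c. \<forall>d<b. a * d + a \<le> c)" for a b :: cord
  unfolding times_cord_def by (subst mult_cord.simps) simp

lemma times_cord_step: "d < b \<Longrightarrow> a * d + a \<le> a * b" for a b d :: cord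
proof -
  have "countable ((\<lambda>d. a * d + a) ` {..<b})"
    by (simp add: countable_lessThan_cord)
  then obtain c where "\<forall>x\<in>(\<lambda>d. a * d + a) ` {..<b}. x < c"
    using cord_countable_bounded by blast
  then have "\<forall>d<b. a * d + a \<le> c" by (auto intro: less_imp_le)
  then have "\<forall>d<b. a * d + a \<le> a * b" by (subst (2) times_cord_eq) (rule LeastI)
  then show "d < b \<Longrightarrow> a * d + a \<le> a * b" by blast
qed

lemma times_cord_least: "(\<And>d. d < b \<Longrightarrow> a * d + a \<le> c) \<Longrightarrow> a * b \<le> c" for a b c :: cord
  by (subst times_cord_eq) (auto intro: Least_le)

lemma less_times_cordE:
  fixes e a b :: cord
  assumes "e < a * b"
  obtains d where "d < b" "e < a * d + a"
  using assms times_cord_least[of b a e] by (meson not_less)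

lemma times_cord_mono: "d \<le> b \<Longrightarrow> a * d \<le> a * b" for a b d :: cord
  using times_cord_step[of d b a] le_plus_cord[of "a * d" a] by (auto simp: le_less)

lemma times_cord_zero: "a * 0 = 0" for a :: cord
  by (rule antisym[OF times_cord_least]) (auto simp: not_le[symmetric])

lemma times_cord_plus: "a * (b + c) = a * b + a * c" for a b c :: cord
proof (induction c rule: less_induct)
  case (less c)
  show ?case
  proof (rule antisym)
    show "a * (b + c) \<le> a * b + a * c"
    proof (rule times_cord_least)
      fix e assume "e < b + c"
      then show "a * e + a \<le> a * b + a * c"
      proof (cases rule: less_plus_cordE)
        case 1
        then show ?thesis using times_cord_step le_plus_cord order_trans by blast
      next
        case (2 d)
        have "a * e + a \<le> a * (b + d) + a"
          by (intro plus_cord_right_mono times_cord_mono 2)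
        also have "\<dots> = a * b + (a * d + a)" using less[OF 2(1)] by (simp add: add.assoc)
        also have "\<dots> \<le> a * b + a * c" by (intro plus_cord_mono times_cord_step 2)
        finally show ?thesis .
      qed
    qed
    show "a * b + a * c \<le> a * (b + c)"
    proof (rule plus_cord_least)
      show "a * b \<le> a * (b + c)" by (intro times_cord_mono le_plus_cord)
      fix e assume "e < a * c"
      then obtain d where d: "d < c" "e < a * d + a" by (rule less_times_cordE)
      have "a * b + e < a * b + (a * d + a)" by (intro plus_cord_strict_mono d)
      also have "\<dots> = a * (b + d) + a" using less[OF d(1)] by (simp add: add.assoc)
      also have "\<dots> \<le> a * (b + c)" by (intro times_cord_step plus_cord_strict_mono d)
      finally show "a * b + e < a * (b + c)" .
    qed
  qed
qed

instance cord :: monoid_mult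
proof
  fix a b c :: cord
  show "1 * a = a"
  proof (induction a rule: less_induct)
    case (less a)
    show ?case
    proof (rule antisym)
      show "1 * a \<le> a" by (rule times_cord_least) (simp add: less plus_one_le_cord_iff)
      show "a \<le> 1 * a"
      proof (rule ccontr)
        assume n: "\<not> a \<le> 1 * a"
        then have "1 * (1 * a) = 1 * a" using less by simp
        then have "1 * a + 1 \<le> 1 * a" using times_cord_step[of "1 * a" a 1] n by simp
        then show False by (simp add: plus_one_le_cord_iff)
      qed
    qed
  qed
  show "a * 1 = a"
  proof (rule antisym)
    show "a * 1 \<le> a"
      by (rule times_cord_least) (simp add: less_one_cord_iff times_cord_zero)
    show "a \<le> a * 1"
      using times_cord_step[of 0 1 a] by (simp add: less_one_cord_iff times_cord_zero)
  qed
  show "a * b * c = a * (b * c)"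
  proof (induction c rule: less_induct)
    case (less c)
    show ?case
    proof (rule antisym)
      show "a * b * c \<le> a * (b * c)"
      proof (rule times_cord_least)
        fix d assume d: "d < c"
        have "a * b * d + a * b = a * (b * d + b)" by (simp add: less[OF d] times_cord_plus)
        also have "\<dots> \<le> a * (b * c)" by (intro times_cord_mono times_cord_step d)
        finally show "a * b * d + a * b \<le> a * (b * c)" .
      qed
      show "a * (b * c) \<le> a * b * c"
      proof (rule times_cord_least)
        fix e assume "e < b * c"
        then obtain d where d: "d < c" "e < b * d + b" by (rule less_times_cordE)
        have "a * e + a \<le> a * (b * d + b)" by (rule times_cord_step[OF d(2)])
        also have "\<dots> = a * b * d + a * b" by (simp add: less[OF d(1)] times_cord_plus)
        also have "\<dots> \<le> a * b * c" by (rule times_cord_step[OF d(1)])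
        finally show "a * e + a \<le> a * b * c" .
      qed
    qed
  qed
qed

instance cord :: numeral ..

text \<open>Finite powers \<open>\<alpha> ^ n\<close> and numerals are now those of the monoid classes. There is no
  \<open>of_nat\<close> into \<open>cord\<close>, because ordinal addition is not commutative.\<close>

primrec ord_of_nat :: "nat \<Rightarrow> cord" where
  "ord_of_nat 0 = 0"
| "ord_of_nat (Suc n) = ord_of_nat n + 1"

definition omega :: cord (\<open>\<omega>\<close>)
  where "\<omega> = (LEAST a. \<forall>n. ord_of_nat n < a)"

lemma ord_of_nat_less_omega: "ord_of_nat n < \<omega>"
proof -
  obtain b where "\<forall>a\<in>range ord_of_nat. a < b"
    using cord_countable_bounded[of "range ord_of_nat"] by auto
  then have "\<forall>n. ord_of_nat n < b" by blast
  then have "\<forall>n. ord_of_nat n < \<omega>" unfolding omega_def by (rule LeastI)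
  then show ?thesis ..
qed

lemma lessThan_omega: "{..<\<omega>} = range ord_of_nat"
proof
  show "{..<\<omega>} \<subseteq> range ord_of_nat"
  proof
    fix a assume "a \<in> {..<\<omega>}"
    then have "\<not> (\<forall>n. ord_of_nat n < a)" unfolding omega_def using not_less_Least by blast
    then have ex: "\<exists>n. a \<le> ord_of_nat n" by (auto simp: not_less)
    define m where "m = (LEAST n. a \<le> ord_of_nat n)"
    have m: "a \<le> ord_of_nat m" unfolding m_def using ex by (rule LeastI_ex)
    have "ord_of_nat m \<le> a"
    proof (cases m)
      case (Suc k)
      then have "\<not> a \<le> ord_of_nat k" unfolding m_def using not_less_Least lessI by metis
      then show ?thesis by (simp add: Suc plus_one_le_cord_iff)
    qed simp
    with m show "a \<in> range ord_of_nat" by (auto intro: antisym)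
  qed
qed (auto simp: ord_of_nat_less_omega)

lemma ord_of_nat_add: "ord_of_nat (m + n) = ord_of_nat m + ord_of_nat n"
  by (induction n) (simp_all add: add.assoc)

lemma ord_of_nat_one: "ord_of_nat 1 = 1"
  by simp

lemma ord_of_nat_numeral: "ord_of_nat (numeral k) = numeral k"
proof (induction k)
  case One
  show ?case by simp
qed (simp_all only: numeral.simps ord_of_nat_add ord_of_nat_one)

section \<open>Closed Ramsey numbers\<close>

definition closed_copy :: "cord set \<Rightarrow> cord \<Rightarrow> bool" where
  "closed_copy X \<beta> \<longleftrightarrow> (\<exists>f g. homeomorphism X {..<\<beta>} f g \<and>
     (\<forall>x\<in>X. \<forall>y\<in>X. x \<le> y \<longleftrightarrow> f x \<le> f y))"

definition closed_arrow :: "cord \<Rightarrow> cord \<Rightarrow> cord \<Rightarrow> bool" where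
  "closed_arrow \<gamma> \<alpha> \<beta> \<longleftrightarrow>
     (\<forall>c \<in> [{..<\<gamma>}]\<^bsup>2\<^esup> \<rightarrow> {0, 1 :: nat}. \<exists>X \<subseteq> {..<\<gamma>}.
        closed_copy X \<alpha> \<and> (\<forall>e\<in>[X]\<^bsup>2\<^esup>. c e = 0) \<or>
        closed_copy X \<beta> \<and> (\<forall>e\<in>[X]\<^bsup>2\<^esup>. c e = 1))"

text \<open>For \<open>\<alpha>, \<beta>\<close> without a countable \<open>\<gamma>\<close> such that \<open>closed_arrow \<gamma> \<alpha> \<beta>\<close>, the value of
  \<open>closed_Ramsey \<alpha> \<beta>\<close> is unspecified; otherwise it is the least such ordinal among all
  ordinals, as the ordinals below a countable one are countable.\<close>

definition closed_Ramsey :: "cord \<Rightarrow> cord \<Rightarrow> cord" where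
  "closed_Ramsey \<alpha> \<beta> = (LEAST \<gamma>. closed_arrow \<gamma> \<alpha> \<beta>)"

end

theory Submission
  imports Defs
begin

text \<open>
  A two-colouring of pairs is viewed as a graph whose edges are the pairs of colour 1. The rank of a
  nonzero ordinal is the exponent of the last term of its Cantor normal form.

  Upper bound. Let the graph on \<open>\<omega> ^ 4 * N\<close> be triangle-free. An iterated nonprincipal ultrafilter
  says what holds for most points of rank \<open>j < 4\<close> below a point \<open>y\<^sub>a = \<omega> ^ 4 * (a + 1)\<close>. If \<open>y\<^sub>a\<close> is
  adjacent to most points below \<open>y\<^sub>b\<close> for two different ranks, then the neighbourhood of \<open>y\<^sub>a\<close>,
  which is independent, contains a closed copy of \<open>\<omega> * n + 1\<close>. Otherwise each of the relations
  of \<open>y\<^sub>a\<close> to the points below \<open>y\<^sub>a\<close> itself, below a later \<open>y\<^sub>b\<close>, and below an earlier \<open>y\<^sub>b\<close> excludes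
  at most one rank, so after applying Ramsey's theorem to the indices one of the four ranks survives;
  sequences of points of that rank converging to the \<open>y\<^sub>a\<close> form an independent closed copy.

  Lower bound. There is a triangle-free graph on the points of rank at most 3 in which no two limit
  points, together with one sufficiently close point below each, are independent. Leaving all points
  of rank at least 4 isolated, an independent closed copy of \<open>\<omega> * n + 1\<close> needs \<open>n - 1\<close> limit points of
  rank at least 4, but below \<open>\<omega> ^ 4 * (n - 2) + 1\<close> there are only \<open>n - 2\<close>.
\<close>

section \<open>Ordinal arithmetic\<close>

text \<open>Left subtraction: \<open>d\<close> is the least ordinal with
  \<open>c \<le> a + d\<close>. Smaller ones give sums below \<open>c\<close>, so the recursion for
  addition keeps \<open>a + d\<close> at or below \<open>c\<close>.\<close>

lemma cord_le_imp_add: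
  fixes a c :: cord
  assumes "a \<le> c"
  obtains d where "c = a + d"
proof -
  have "c \<le> a + c" using plus_cord_right_mono[of 0 a c] by simp
  then have 1: "c \<le> a + (LEAST d. c \<le> a + d)" by (rule LeastI)
  have "a + (LEAST d. c \<le> a + d) \<le> c"
    by (rule plus_cord_least) (use assms not_less_Least in \<open>auto simp: not_le[symmetric]\<close>)
  with 1 that show ?thesis by (metis antisym)
qed

lemma less_plus_one_cord: "a < a + 1" for a :: cord
  using plus_one_le_cord_iff[of a "a + 1"] by simp

lemma less_plus_one_cord_iff: "a < b + 1 \<longleftrightarrow> a \<le> b" for a b :: cord
  by (metis less_plus_one_cord leD leI le_less_trans plus_one_le_cord_iff)

lemma ord_of_nat_less_iff [simp]: "ord_of_nat m < ord_of_nat n \<longleftrightarrow> m < n"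
proof -
  have "strict_mono ord_of_nat"
    by (rule strict_monoI_Suc) (simp add: less_plus_one_cord)
  then show ?thesis by (rule strict_mono_less)
qed

lemma ord_of_nat_le_iff [simp]: "ord_of_nat m \<le> ord_of_nat n \<longleftrightarrow> m \<le> n"
  by (simp add: not_less[symmetric])

lemma ord_of_nat_eq_iff [simp]: "ord_of_nat m = ord_of_nat n \<longleftrightarrow> m = n"
  by (metis ord_of_nat_le_iff eq_iff)

lemma less_ord_of_natE:
  assumes "a < ord_of_nat n"
  obtains m where "a = ord_of_nat m" "m < n"
proof -
  have "a < \<omega>" using assms ord_of_nat_less_omega less_trans by blast
  then obtain m where "a = ord_of_nat m" using lessThan_omega by blast
  with assms that show ?thesis by simp
qed

lemma plus_cord_less_iff [simp]: "a + b < a + c \<longleftrightarrow> b < c" for a b c :: cord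
  by (metis leD leI plus_cord_mono plus_cord_strict_mono)

lemma times_cord_strict_mono: "0 < a \<Longrightarrow> b < c \<Longrightarrow> a * b < a * c" for a b c :: cord
  by (metis add.right_neutral less_le_trans plus_cord_strict_mono times_cord_step)

lemma times_cord_less_iff: "0 < a \<Longrightarrow> a * b < a * c \<longleftrightarrow> b < c" for a b c :: cord
  by (metis leD leI times_cord_mono times_cord_strict_mono)

text \<open>From \<open>a * b < b\<close>, strict monotonicity makes \<open>a * b\<close> a smaller
  counterexample.\<close>

lemma le_times_cord: "0 < a \<Longrightarrow> b \<le> a * b" for a b :: cord
proof (induction b rule: less_induct)
  case (less b)
  show ?case
  proof (rule ccontr)
    assume "\<not> b \<le> a * b"
    then have "a * b < b" by simp
    moreover from this have "a * (a * b) < a * b" by (rule times_cord_strict_mono[OF less.prems])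
    ultimately show False using less.IH[OF _ less.prems] by (metis not_less)
  qed
qed

lemma omega_pos: "0 < \<omega>"
  using ord_of_nat_less_omega[of 0] by simp

lemma one_cord_pos: "0 < (1 :: cord)"
  by (simp add: less_one_cord_iff)

lemma omega_power_pos: "0 < \<omega> ^ k"
proof (induction k)
  case (Suc k)
  have "\<omega> * 0 < \<omega> * \<omega> ^ k" by (intro times_cord_strict_mono omega_pos Suc)
  then show ?case by (simp add: times_cord_zero)
qed (simp add: one_cord_pos)

section \<open>Closed copies\<close>

definition omega_idx :: "nat \<Rightarrow> nat \<Rightarrow> cord" where
  "omega_idx i t = \<omega> * ord_of_nat i + ord_of_nat t"

lemma omega_idx_less_iff:
  "omega_idx i t < omega_idx j u \<longleftrightarrow> i < j \<or> i = j \<and> t < u"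
proof -
  have *: "omega_idx i t < omega_idx j u" if "i < j" for i j t u
  proof -
    have "omega_idx i t < \<omega> * ord_of_nat i + \<omega>"
      unfolding omega_idx_def by (simp add: ord_of_nat_less_omega)
    also have "\<dots> \<le> \<omega> * ord_of_nat j" by (rule times_cord_step) (simp add: that)
    also have "\<dots> \<le> omega_idx j u" unfolding omega_idx_def by (rule le_plus_cord)
    finally show ?thesis .
  qed
  show ?thesis
    using *[of i j t u] *[of j i u t] by (cases i j rule: linorder_cases) (auto simp: omega_idx_def)
qed

lemma omega_idx_eq_iff: "omega_idx i t = omega_idx j u \<longleftrightarrow> i = j \<and> t = u"
  by (metis less_irrefl linorder_neqE_nat omega_idx_less_iff)

lemma less_omega_timesE:
  assumes "c < \<omega> * ord_of_nat n"
  obtains i t where "i < n" "c = omega_idx i t"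
  using assms
proof (induction n arbitrary: thesis)
  case 0
  then show ?case using zero_le_cord[of c] by (simp add: times_cord_zero leD)
next
  case (Suc n)
  show ?case
  proof (cases "c < \<omega> * ord_of_nat n")
    case True
    then show ?thesis using Suc less_Suc_eq by metis
  next
    case False
    then obtain d where d: "c = \<omega> * ord_of_nat n + d" using cord_le_imp_add not_less by metis
    have "d < \<omega>" using Suc.prems(2) by (simp add: d times_cord_plus)
    then obtain t where "d = ord_of_nat t" using lessThan_omega by blast
    then show ?thesis using Suc.prems(1)[of n t] d by (simp add: omega_idx_def)
  qed
qed

lemma lessThan_omega_times_plus_one:
  "{..<\<omega> * ord_of_nat n + 1} = {omega_idx i t |i t. i < n} \<union> {omega_idx n 0}" (is "?A = ?B")
proof
  show "?A \<subseteq> ?B"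
  proof
    fix c assume "c \<in> ?A"
    then have "c < \<omega> * ord_of_nat n \<or> c = omega_idx n 0"
      by (simp add: less_plus_one_cord_iff le_less omega_idx_def)
    then show "c \<in> ?B" using less_omega_timesE[of c n] by blast
  qed
  have "omega_idx i t < \<omega> * ord_of_nat n" if "i < n" for i t
    using that omega_idx_less_iff[of i t n 0] by (simp add: omega_idx_def[of n 0])
  then show "?B \<subseteq> ?A"
    by (auto simp: less_plus_one_cord_iff less_imp_le omega_idx_def[of n 0])
qed

section \<open>Increasing maps that are continuous at limits\<close>

text \<open>A strictly increasing map has a continuous inverse on its image and pulls initial
  segments back to initial segments. Only the rays \<open>{p<..}\<close> could have preimages that
  are not open, and \<open>cont\<close> excludes this at limits.\<close>

lemma closed_copy_image:
  fixes g :: "cord \<Rightarrow> cord"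
  assumes mono: "\<And>c d. c < d \<Longrightarrow> d < \<beta> \<Longrightarrow> g c < g d"
    and cont: "\<And>c p. c < \<beta> \<Longrightarrow> p < g c \<Longrightarrow> c = 0 \<or> (\<exists>d. c = d + 1) \<or> (\<exists>d<c. p < g d)"
  shows "closed_copy (g ` {..<\<beta>}) \<beta>"
proof -
  have less: "g c < g d \<longleftrightarrow> c < d" if "c < \<beta>" "d < \<beta>" for c d
    using mono that by (metis less_asym linorder_neqE)
  have inj: "inj_on g {..<\<beta>}" by (rule inj_onI) (metis lessThan_iff less less_irrefl linorder_neqE)
  define f where "f = the_inv_into {..<\<beta>} g"
  have fg: "f (g c) = c" if "c < \<beta>" for c
    unfolding f_def using inj that by (simp add: the_inv_into_f_f)
  have contg: "continuous_on {..<\<beta>} g"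
  proof (rule continuous_on_generate_topology[OF open_cord_def])
    fix B :: "cord set" assume "B \<in> range (\<lambda>a. {..<a}) \<union> range (\<lambda>a. {a<..})"
    then consider p where "B = {..<p}" | p where "B = {p<..}" by blast
    then show "\<exists>C. open C \<and> C \<inter> {..<\<beta>} = g -` B \<inter> {..<\<beta>}"
    proof cases
      case (1 p)
      show ?thesis
      proof (cases "\<exists>c<\<beta>. p \<le> g c")
        case True
        define c where "c = (LEAST c. c < \<beta> \<and> p \<le> g c)"
        have c: "c < \<beta>" "p \<le> g c" using LeastI_ex[OF True] unfolding c_def by auto
        have min: "g d < p" if "d < c" for d
          using not_less_Least[of d] that c(1) unfolding c_def[symmetric] by (metis not_le order.strict_trans c_def)
        have "{..<c} \<inter> {..<\<beta>} = g -` B \<inter> {..<\<beta>}"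
        proof -
          have "d < c" if "g d < p" "d < \<beta>" for d
          proof (rule ccontr)
            assume "\<not> d < c"
            then have "g c \<le> g d" using mono[of c d] that(2) by (cases "c = d") (auto simp: not_less le_less)
            then show False using c(2) that(1) by simp
          qed
          then show ?thesis using min 1 by auto
        qed
        then show ?thesis using open_lessThan by blast
      next
        case False
        then have "UNIV \<inter> {..<\<beta>} = g -` B \<inter> {..<\<beta>}" using 1 by (auto simp: not_le)
        then show ?thesis using open_UNIV by blast
      qed
    next
      case (2 p)
      show ?thesis
      proof (cases "\<exists>c<\<beta>. p < g c")
        case True
        define c where "c = (LEAST c. c < \<beta> \<and> p < g c)"
        have c: "c < \<beta>" "p < g c" using LeastI_ex[OF True] unfolding c_def by auto
        have min: "\<not> p < g d" if "d < c" for d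
          using not_less_Least[of d] that c(1) by (metis c_def order.strict_trans)
        have eq: "{c..} \<inter> {..<\<beta>} = g -` B \<inter> {..<\<beta>}"
        proof -
          have "p < g d" if "c \<le> d" "d < \<beta>" for d
            using c(2) mono[of c d] that by (metis le_less less_trans)
          moreover have "c \<le> d" if "p < g d" for d using min[of d] that by (meson not_le)
          ultimately show ?thesis using 2 by auto
        qed
        \<comment> \<open>By minimality of \<open>c\<close> the third alternative of
          \<open>cont\<close> is impossible, and the final segment starting at 0 or at a successor
          is open.\<close>
        have "open {c..}"
          using cont[OF c]
        proof (elim disjE)
          assume "c = 0"
          then have "{c..} = UNIV" by auto
          then show ?thesis by simp
        next
          assume "\<exists>d. c = d + 1"
          then obtain d where "c = d + 1" by blast
          then have "{c..} = {d<..}" by (auto simp: plus_one_le_cord_iff)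
          then show ?thesis by simp
        qed (use min in blast)
        with eq show ?thesis by blast
      next
        case False
        then have "{} \<inter> {..<\<beta>} = g -` B \<inter> {..<\<beta>}" using 2 by auto
        then show ?thesis using open_empty by blast
      qed
    qed
  qed
  have contf: "continuous_on (g ` {..<\<beta>}) f"
  proof (rule continuous_on_generate_topology[OF open_cord_def])
    fix B :: "cord set" assume "B \<in> range (\<lambda>a. {..<a}) \<union> range (\<lambda>a. {a<..})"
    then consider p where "B = {..<p}" | p where "B = {p<..}" by blast
    then show "\<exists>C. open C \<and> C \<inter> g ` {..<\<beta>} = f -` B \<inter> g ` {..<\<beta>}"
    proof cases
      case (1 p)
      show ?thesis
      proof (cases "p < \<beta>")
        case True
        then have "{..<g p} \<inter> g ` {..<\<beta>} = f -` B \<inter> g ` {..<\<beta>}"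
          using 1 by (auto simp: fg less)
        then show ?thesis using open_lessThan by blast
      next
        case False
        then have "UNIV \<inter> g ` {..<\<beta>} = f -` B \<inter> g ` {..<\<beta>}"
          using 1 by (auto simp: fg)
        then show ?thesis using open_UNIV by blast
      qed
    next
      case (2 p)
      show ?thesis
      proof (cases "p < \<beta>")
        case True
        then have "{g p<..} \<inter> g ` {..<\<beta>} = f -` B \<inter> g ` {..<\<beta>}"
          using 2 by (auto simp: fg less)
        then show ?thesis using open_greaterThan by blast
      next
        case False
        then have "{} \<inter> g ` {..<\<beta>} = f -` B \<inter> g ` {..<\<beta>}"
          using 2 by (auto simp: fg)
        then show ?thesis using open_empty by blast
      qed
    qed
  qed
  have "homeomorphism (g ` {..<\<beta>}) {..<\<beta>} f g"
    using contf contg fg by (auto simp: homeomorphism_def image_image)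
  moreover have "\<forall>x\<in>g ` {..<\<beta>}. \<forall>y\<in>g ` {..<\<beta>}. x \<le> y \<longleftrightarrow> f x \<le> f y"
    using fg less by (auto simp: not_less[symmetric])
  ultimately show ?thesis unfolding closed_copy_def by blast
qed

text \<open>Converse of \<open>closed_copy_image\<close>: at a limit \<open>c\<close> the preimage
  of \<open>{p<..}\<close> contains some \<open>{b<..c}\<close>, hence \<open>b + 1\<close>, which
  is still below \<open>c\<close>.\<close>

lemma closed_copyE:
  assumes "closed_copy X \<beta>"
  obtains g where "X = g ` {..<\<beta>}" "\<And>c d. c < d \<Longrightarrow> d < \<beta> \<Longrightarrow> g c < g d"
    "\<And>c p. c < \<beta> \<Longrightarrow> p < g c \<Longrightarrow> 0 < c \<Longrightarrow> (\<And>d. d < c \<Longrightarrow> d + 1 < c) \<Longrightarrow> \<exists>d<c. p < g d"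
proof -
  obtain f g where h: "homeomorphism X {..<\<beta>} f g"
    and ord: "\<And>x y. x \<in> X \<Longrightarrow> y \<in> X \<Longrightarrow> x \<le> y \<longleftrightarrow> f x \<le> f y"
    using assms unfolding closed_copy_def by blast
  have im: "X = g ` {..<\<beta>}" using h by (simp add: homeomorphism_def)
  have fg: "f (g c) = c" "g c \<in> X" if "c < \<beta>" for c
    using h that by (auto simp: homeomorphism_def)
  have mono: "g c < g d" if "c < d" "d < \<beta>" for c d
    using ord[of "g d" "g c"] fg[of c] fg[of d] that by (auto simp: not_less[symmetric])
  have "\<exists>d<c. p < g d"
    if c: "c < \<beta>" "p < g c" "0 < c" and lim: "\<And>d. d < c \<Longrightarrow> d + 1 < c" for c p
  proof -
    have "continuous_on {..<\<beta>} g" using h by (simp add: homeomorphism_def)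
    then obtain A where A: "open A" "A \<inter> {..<\<beta>} = g -` {p<..} \<inter> {..<\<beta>}"
      unfolding continuous_on_open_invariant using open_greaterThan by metis
    then have "c \<in> A" using c by blast
    then obtain b where b: "b < c" "{b<..c} \<subseteq> A" using open_left[OF A(1) _ c(3)] by blast
    then have "b + 1 \<in> A \<inter> {..<\<beta>}"
      using lim[OF b(1)] c(1) less_plus_one_cord[of b] by auto
    then have "p < g (b + 1)" using A(2) by blast
    then show ?thesis using lim[OF b(1)] by blast
  qed
  with im mono that show ?thesis by blast
qed

text \<open>Row \<open>i\<close> of \<open>w\<close> increases to the first entry of row
  \<open>Suc i\<close>, which thus ends one row and starts the next. Those entries sit at the
  nonzero limit ordinals, the only places where continuity is at stake.\<close>

lemma closed_copy_omega_timesI: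
  fixes w :: "nat \<Rightarrow> nat \<Rightarrow> cord"
  assumes step: "\<And>i t. i < n \<Longrightarrow> w i t < w i (Suc t)"
    and block: "\<And>i t. i < n \<Longrightarrow> w i t < w (Suc i) 0"
    and lim: "\<And>i p. i < n \<Longrightarrow> p < w (Suc i) 0 \<Longrightarrow> \<exists>t. p < w i t"
  shows "closed_copy ({w i t |i t. i < n} \<union> {w n 0}) (\<omega> * ord_of_nat n + 1)"
proof -
  define g where "g c = (case (THE (i, t). c = omega_idx i t) of (i, t) \<Rightarrow> w i t)" for c
  have g: "g (omega_idx i t) = w i t" for i t
  proof -
    have "(THE (j, u). omega_idx i t = omega_idx j u) = (i, t)"
      by (rule the_equality) (auto simp: omega_idx_eq_iff)
    then show ?thesis by (simp add: g_def)
  qed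
  have within: "w i t < w i u" if "i < n" "t < u" for i t u
    using step[OF that(1)] that(2) by (rule lift_Suc_mono_less[of "w i"])
  have start: "w i 0 \<le> w i t" if "i < n" for i t
    using within[OF that, of 0 t] by (cases t) auto
  have across: "w i t < w j 0" if "i < j" "j \<le> n" for i j t
    using that
  proof (induction j)
    case (Suc j)
    show ?case
    proof (cases "i = j")
      case False
      then have "w i t < w j 0" using Suc by simp
      also have "\<dots> < w (Suc j) 0" using Suc.prems by (intro block) simp
      finally show ?thesis .
    qed (use Suc.prems block in simp)
  qed simp
  have "closed_copy (g ` {..<\<omega> * ord_of_nat n + 1}) (\<omega> * ord_of_nat n + 1)"
  proof (rule closed_copy_image)
    fix c d assume cd: "c < d" "d < \<omega> * ord_of_nat n + 1"
    obtain j u where d: "d = omega_idx j u" "j < n \<or> j = n \<and> u = 0"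
      using cd(2) lessThan_omega_times_plus_one[of n] by blast
    have "c < \<omega> * ord_of_nat n + 1" using cd by (rule less_trans)
    then obtain i t where c: "c = omega_idx i t" "i < n \<or> i = n \<and> t = 0"
      using lessThan_omega_times_plus_one[of n] by blast
    have "w i t < w j u"
    proof (cases "i = j")
      case True
      then show ?thesis using cd(1) c d within[of i t u] by (auto simp: omega_idx_less_iff)
    next
      case False
      then have "i < j" using cd(1) by (simp add: c d omega_idx_less_iff)
      then have "w i t < w j 0" using d(2) by (intro across) auto
      then show ?thesis using start[of j u] d(2) by auto
    qed
    then show "g c < g d" by (simp add: c d g)
  next
    fix c p assume c: "c < \<omega> * ord_of_nat n + 1" and p: "p < g c"
    obtain i t where i: "c = omega_idx i t" "i < n \<or> i = n \<and> t = 0"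
      using c lessThan_omega_times_plus_one[of n] by blast
    show "c = 0 \<or> (\<exists>d. c = d + 1) \<or> (\<exists>d<c. p < g d)"
    proof (cases t)
      case (Suc u)
      then have "c = omega_idx i u + 1" by (simp add: i omega_idx_def add.assoc)
      then show ?thesis by blast
    next
      case 0
      show ?thesis
      proof (cases i)
        case 0
        with \<open>t = 0\<close> show ?thesis by (simp add: i omega_idx_def times_cord_zero)
      next
        case (Suc j)
        then have "\<exists>u. p < w j u" using p i by (intro lim) (auto simp: g \<open>t = 0\<close>)
        then obtain u where "p < g (omega_idx j u)" by (auto simp: g)
        moreover have "omega_idx j u < c" by (simp add: i Suc omega_idx_less_iff)
        ultimately show ?thesis by blast
      qed
    qed
  qed
  moreover have "g ` {..<\<omega> * ord_of_nat n + 1} = {w i t |i t. i < n} \<union> {w n 0}"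
  proof -
    have "g ` {omega_idx i t |i t. i < n} = {w i t |i t. i < n}"
    proof (intro equalityI subsetI)
      fix x assume "x \<in> {w i t |i t. i < n}"
      then obtain i t where "x = g (omega_idx i t)" "i < n" by (auto simp: g)
      then show "x \<in> g ` {omega_idx i t |i t. i < n}" by blast
    next
      fix x assume "x \<in> g ` {omega_idx i t |i t. i < n}"
      then obtain i t where "x = g (omega_idx i t)" "i < n" by blast
      then show "x \<in> {w i t |i t. i < n}" unfolding g by blast
    qed
    then show ?thesis unfolding lessThan_omega_times_plus_one image_Un by (simp add: g)
  qed
  ultimately show ?thesis by simp
qed

lemma closed_copy_omega_timesD:
  assumes "closed_copy X (\<omega> * ord_of_nat n + 1)"
  shows "\<exists>w. (\<forall>i<n. \<forall>t. w i t \<in> X) \<and> w n 0 \<in> X \<and> (\<forall>i<n. \<forall>t. w i t < w (Suc i) (0 :: nat)) \<and>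
    (\<forall>i<n. \<forall>p<w (Suc i) 0. \<exists>t. p < w i t)"
proof -
  obtain g where g: "X = g ` {..<\<omega> * ord_of_nat n + 1}"
    "\<And>c d. c < d \<Longrightarrow> d < \<omega> * ord_of_nat n + 1 \<Longrightarrow> g c < g d"
    "\<And>c p. c < \<omega> * ord_of_nat n + 1 \<Longrightarrow> p < g c \<Longrightarrow> 0 < c \<Longrightarrow> (\<And>d. d < c \<Longrightarrow> d + 1 < c)
       \<Longrightarrow> \<exists>d<c. p < g d"
    using closed_copyE[OF assms] by metis
  have mem: "omega_idx i t < \<omega> * ord_of_nat n + 1" if "i < n \<or> i = n \<and> t = 0" for i t
    using that lessThan_omega_times_plus_one[of n] by blast
  show ?thesis
  proof (intro exI[of _ "\<lambda>i t. g (omega_idx i t)"] conjI allI impI)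
    show "g (omega_idx i t) \<in> X" if "i < n" for i t using mem that g(1) by blast
    show "g (omega_idx n 0) \<in> X" using mem g(1) by blast
    show "g (omega_idx i t) < g (omega_idx (Suc i) 0)" if "i < n" for i t
      using that by (intro g(2) mem) (auto simp: omega_idx_less_iff)
  next
    fix i p assume i: "i < n" and p: "p < g (omega_idx (Suc i) 0)"
    let ?c = "omega_idx (Suc i) 0"
    have "0 < ?c" using omega_idx_less_iff[of 0 0 "Suc i" 0] by (simp add: omega_idx_def times_cord_zero)
    moreover have below: "\<exists>j u. d = omega_idx j u \<and> j \<le> i" if "d < ?c" for d
      using that less_omega_timesE[of d "Suc i"] unfolding omega_idx_def[of "Suc i" 0] by (simp add: less_Suc_eq_le) metis
    moreover have "omega_idx j u + 1 = omega_idx j (Suc u)" for j u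
      by (simp add: omega_idx_def add.assoc)
    ultimately have "\<exists>d<?c. p < g d"
      using i p by (intro g(3) mem) (auto dest!: below simp: omega_idx_less_iff)
    then obtain j u where ju: "j \<le> i" "p < g (omega_idx j u)" using below by blast
    \<comment> \<open>The ordinal found may lie in an earlier row; the same column of row
      \<open>i\<close> has at least as large a value.\<close>
    have "g (omega_idx j u) \<le> g (omega_idx i u)"
      using ju(1) i by (cases "j = i") (auto intro!: less_imp_le g(2) mem simp: omega_idx_less_iff)
    then show "\<exists>t. p < g (omega_idx i t)" using ju(2) less_le_trans by blast
  qed
qed

lemma lessThan_three_cord: "{..<3 :: cord} = ord_of_nat ` {..<3}"
proof -
  have "{..<ord_of_nat n} = ord_of_nat ` {..<n}" for n
    by (auto elim: less_ord_of_natE)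
  from this[of 3] show ?thesis by (simp add: ord_of_nat_numeral)
qed

lemma card_closed_copy_3:
  assumes "closed_copy X 3"
  shows "card X = 3"
proof -
  obtain g where g: "X = g ` {..<3 :: cord}" "\<And>c d. c < d \<Longrightarrow> d < 3 \<Longrightarrow> g c < g d"
    using closed_copyE[OF assms] by metis
  have "inj_on g {..<3}" by (rule inj_onI) (metis g(2) lessThan_iff less_irrefl linorder_neqE)
  then have "card X = card (ord_of_nat ` {..<3})" by (simp add: g(1) card_image lessThan_three_cord)
  also have "\<dots> = 3" by (subst card_image) (auto simp: inj_on_def)
  finally show ?thesis .
qed

text \<open>Every ordinal below 3 is zero or a successor, so continuity is automatic.\<close>

lemma closed_copy_3:
  assumes "a < b" "b < c"
  shows "closed_copy {a, b, c} 3"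
proof -
  define g where "g x = (if x = ord_of_nat 0 then a else if x = ord_of_nat 1 then b else c)" for x
  have "closed_copy (g ` {..<3}) 3"
  proof (rule closed_copy_image)
    fix x y :: cord assume xy: "x < y" "y < 3"
    then obtain n where n: "y = ord_of_nat n" "n < 3" using lessThan_three_cord by blast
    then obtain m where m: "x = ord_of_nat m" "m < n" using xy less_ord_of_natE by metis
    consider "m = 0" "n = 1" | "m = 0" "n = 2" | "m = 1" "n = 2" using m(2) n(2) by linarith
    then show "g x < g y" using assms by cases (auto simp: g_def m(1) n(1) simp del: ord_of_nat.simps)
  next
    fix x :: cord and p assume "x < 3"
    then obtain n where n: "x = ord_of_nat n" using lessThan_three_cord by blast
    show "x = 0 \<or> (\<exists>d. x = d + 1) \<or> (\<exists>d<x. p < g d)" by (cases n) (auto simp: n)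
  qed
  moreover have "{..<3 :: nat} = {0, 1, 2}" by auto
  then have "g ` {..<3} = {a, b, c}"
    unfolding lessThan_three_cord by (auto simp: g_def simp del: ord_of_nat.simps)
  ultimately show ?thesis by simp
qed

section \<open>The lower bound\<close>

text \<open>The iterated Cantor-Bendixson derivatives, except that 0 stays in every level
  vacuously.\<close>

primrec limits :: "nat \<Rightarrow> cord set" where
  "limits 0 = UNIV"
| "limits (Suc k) = {y. \<forall>p<y. \<exists>x\<in>limits k. p < x \<and> x < y}"

lemma limits_closed:
  assumes "\<And>p. p < y \<Longrightarrow> \<exists>x\<in>limits k. p < x \<and> x < y"
  shows "y \<in> limits k"
proof (cases k)
  case (Suc j)
  show ?thesis unfolding Suc limits.simps mem_Collect_eq
  proof (intro allI impI)
    fix p assume "p < y"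
    then obtain x where x: "x \<in> limits k" "p < x" "x < y" using assms by blast
    then obtain z where "z \<in> limits j" "p < z" "z < x" unfolding Suc limits.simps by blast
    then show "\<exists>x\<in>limits j. p < x \<and> x < y" using x(3) less_trans by blast
  qed
qed simp

lemma limits_Suc_subset: "limits (Suc k) \<subseteq> limits k"
  using limits_closed by auto

lemma limits_antimono: "j \<le> k \<Longrightarrow> limits k \<subseteq> limits j"
  using limits_Suc_subset by (rule lift_Suc_antimono_le)

text \<open>Write \<open>y\<close> as \<open>\<omega> ^ k * b\<close>. Since \<open>y\<close> is a
  limit of multiples of \<open>\<omega> ^ k\<close>, \<open>b\<close> has no predecessor, so
  dividing \<open>b\<close> by \<omega> leaves remainder 0.\<close>

lemma limits_multiples: "limits k \<subseteq> range ((*) (\<omega> ^ k))"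
proof (induction k)
  case (Suc k)
  show ?case
  proof
    fix y assume y: "y \<in> limits (Suc k)"
    then obtain b where b: "y = \<omega> ^ k * b" using limits_Suc_subset Suc by blast
    have succ: "c + 1 < b" if "c < b" for c
    proof -
      have "\<omega> ^ k * c < y" unfolding b by (intro times_cord_strict_mono omega_power_pos that)
      then obtain x where x: "x \<in> limits k" "\<omega> ^ k * c < x" "x < y"
        using y unfolding limits.simps by blast
      then obtain d where "x = \<omega> ^ k * d" using Suc by blast
      then have "c < d" "d < b" using x b by (simp_all add: times_cord_less_iff omega_power_pos)
      then show ?thesis by (metis le_less_trans plus_one_le_cord_iff)
    qed
    have "b < b + 1" by (rule less_plus_one_cord)
    also have "\<dots> \<le> \<omega> * (b + 1)"
      by (rule le_times_cord[OF omega_pos])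
    finally have ex: "b < \<omega> * (b + 1)" .
    define e where "e = (LEAST e. b < \<omega> * e)"
    have e: "b < \<omega> * e" unfolding e_def using ex by (rule LeastI)
    then obtain d where d: "d < e" "b < \<omega> * d + \<omega>" by (rule less_times_cordE)
    have "\<omega> * d \<le> b" using not_less_Least[of d "\<lambda>e. b < \<omega> * e"] d(1) by (simp add: e_def not_less)
    then obtain r where r: "b = \<omega> * d + r" by (rule cord_le_imp_add)
    then have "r < \<omega>" using d(2) by simp
    then obtain t where t: "r = ord_of_nat t" using lessThan_omega by blast
    have "t = 0"
    proof (rule ccontr)
      assume "t \<noteq> 0"
      then obtain u where "t = Suc u" by (cases t) auto
      then have "b = (\<omega> * d + ord_of_nat u) + 1" by (simp add: r t add.assoc)
      then show False using succ[of "\<omega> * d + ord_of_nat u"] less_plus_one_cord by auto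
    qed
    then have "y = \<omega> ^ Suc k * d" by (simp add: b r t power_Suc2 mult.assoc del: power_Suc)
    then show "y \<in> range ((*) (\<omega> ^ Suc k))" by blast
  qed
qed simp

text \<open>The least strict upper bound of an increasing sequence taken from
  \<open>limits k\<close> above \<open>x\<close> lies in the next level; it exists because countable
  sets are bounded.\<close>

lemma limits_unbounded: "\<exists>y\<in>limits k. x < y"
proof (induction k arbitrary: x)
  case 0
  show ?case using less_plus_one_cord by auto
next
  case (Suc k)
  define s where "s x = (SOME y. y \<in> limits k \<and> x < y)" for x
  have s: "s x \<in> limits k" "x < s x" for x
    unfolding s_def using someI_ex[OF Suc[of x, unfolded Bex_def]] by auto
  define f where "f n = (s ^^ n) x" for n
  define b where "b = (LEAST b. \<forall>n. f n < b)"
  have "\<exists>b. \<forall>n. f n < b" using cord_countable_bounded[of "range f"] by auto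
  then have "\<forall>n. f n < b" unfolding b_def by (rule LeastI_ex)
  then have b: "f n < b" for n ..
  have "\<exists>z\<in>limits k. p < z \<and> z < b" if p: "p < b" for p
  proof -
    have "\<not> (\<forall>n. f n < p)" using p unfolding b_def by (rule not_less_Least)
    then obtain n where "p \<le> f n" by (auto simp: not_less)
    also have "\<dots> < f (Suc n)" by (simp add: f_def s)
    finally have "p < f (Suc n)" .
    moreover have "f (Suc n) \<in> limits k" by (simp add: f_def s)
    ultimately show ?thesis using b by blast
  qed
  then have "b \<in> limits (Suc k)" by simp
  moreover have "x < b" using b[of 0] by (simp add: f_def)
  ultimately show ?case by blast
qed

text \<open>The ancestor of rank at least \<open>k\<close> of \<open>x\<close> in the tree of ranks: for \<open>y\<close> of rank \<open>k\<close>, the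
  solutions of \<open>rank_up k x = y\<close> form a neighbourhood of \<open>y\<close> in \<open>{..y}\<close>.\<close>

definition rank_up :: "nat \<Rightarrow> cord \<Rightarrow> cord" where
  "rank_up k x = (LEAST y. y \<in> limits k \<and> x \<le> y)"

lemma rank_up: "rank_up k x \<in> limits k" "x \<le> rank_up k x"
proof -
  have "\<exists>y. y \<in> limits k \<and> x \<le> y" using limits_unbounded[of k x] less_imp_le by blast
  then have "rank_up k x \<in> limits k \<and> x \<le> rank_up k x" unfolding rank_up_def by (rule LeastI_ex)
  then show "rank_up k x \<in> limits k" "x \<le> rank_up k x" by auto
qed

lemma rank_up_least: "y \<in> limits k \<Longrightarrow> x \<le> y \<Longrightarrow> rank_up k x \<le> y"
  unfolding rank_up_def by (simp add: Least_le)

text \<open>Ancestors compose because \<open>limits k\<close> is contained in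
  \<open>limits j\<close>.\<close>

lemma rank_up_rank_up:
  assumes "j \<le> k"
  shows "rank_up k (rank_up j x) = rank_up k x"
proof (rule antisym)
  have "rank_up k x \<in> limits j" using limits_antimono[OF assms] rank_up(1) by blast
  then have "rank_up j x \<le> rank_up k x" using rank_up(2) by (rule rank_up_least)
  then show "rank_up k (rank_up j x) \<le> rank_up k x" by (rule rank_up_least[OF rank_up(1)])
  show "rank_up k x \<le> rank_up k (rank_up j x)"
    using order_trans[OF rank_up(2) rank_up(2)] by (rule rank_up_least[OF rank_up(1)])
qed

text \<open>Since \<open>0\<close> lies in every \<open>limits k\<close>, it has no rank.\<close>

definition has_rank :: "nat \<Rightarrow> cord \<Rightarrow> bool" where
  "has_rank k x \<longleftrightarrow> x \<in> limits k \<and> x \<notin> limits (Suc k)"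

lemma has_rank_unique: "has_rank j x \<Longrightarrow> has_rank k x \<Longrightarrow> j = k"
  unfolding has_rank_def
  by (metis Suc_leI limits_antimono linorder_neqE_nat subsetD)

lemma ex_has_rank: "x \<notin> limits k \<Longrightarrow> \<exists>j<k. has_rank j x"
proof (induction k)
  case (Suc k)
  then show ?case
    by (cases "x \<in> limits k") (use less_Suc_eq in \<open>auto simp: has_rank_def simp del: limits.simps(2)\<close>)
qed simp

text \<open>As \<open>y\<close> is not in \<open>limits (Suc k)\<close>, some \<open>p\<close> below
  it has no member of \<open>limits k\<close> strictly between; an ancestor of a later point cannot
  stop before \<open>y\<close>.\<close>

lemma rank_up_eq_near:
  assumes "has_rank k y"
  obtains p where "p < y" "\<And>x. p < x \<Longrightarrow> x \<le> y \<Longrightarrow> rank_up k x = y"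
proof -
  obtain p where p: "p < y" "\<And>x. x \<in> limits k \<Longrightarrow> p < x \<Longrightarrow> \<not> x < y"
    using assms unfolding has_rank_def limits.simps by blast
  have "rank_up k x = y" if "p < x" "x \<le> y" for x
  proof -
    have "rank_up k x \<le> y" using assms that unfolding has_rank_def by (intro rank_up_least) auto
    moreover have "p < rank_up k x" using that(1) rank_up(2) less_le_trans by blast
    ultimately show ?thesis using p(2)[OF rank_up(1), of x] by auto
  qed
  with p(1) that show ?thesis by blast
qed

section \<open>A triangle-free graph on the ranks 0 to 3\<close>

text \<open>Whether \<open>x\<close> and a point \<open>z\<close> of smaller rank are adjacent depends on their ranks and on whether
  \<open>z\<close> is a descendant of \<open>x\<close>, lies after \<open>x\<close>, or lies before \<open>x\<close> without being a descendant. A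
  relation serving two ranks of \<open>z\<close> would put closed copies into the independent neighbourhood of \<open>x\<close>,
  so for \<open>x\<close> of rank 3 the ranks 0, 1, 2 of \<open>z\<close> take one relation each. The
  last alternative \<open>rank_up 3 z = rank_up 3 x\<close> handles a limit point of rank 2 that is a descendant
  of a limit point of rank 3, the one case no table of pure relations covers.\<close>

definition adj_below :: "cord \<Rightarrow> cord \<Rightarrow> bool" where
  "adj_below x z \<longleftrightarrow>
     (\<exists>k\<in>{1, 2, 3}. has_rank k x \<and> has_rank 0 z \<and> rank_up k z = x) \<or>
     has_rank 3 x \<and> has_rank 1 z \<and> z < x \<and> rank_up 3 z \<noteq> x \<or>
     has_rank 3 x \<and> has_rank 2 z \<and> x < z \<or>
     has_rank 2 x \<and> has_rank 1 z \<and> rank_up 2 z \<noteq> x \<and> (x < z \<or> rank_up 3 z = rank_up 3 x)"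

definition adj :: "cord \<Rightarrow> cord \<Rightarrow> bool" where
  "adj x z \<longleftrightarrow> adj_below x z \<or> adj_below z x"

lemma adj_sym: "adj x z \<longleftrightarrow> adj z x"
  by (auto simp: adj_def)

lemma adj_below_rank:
  assumes "adj_below x z"
  obtains j k where "has_rank k x" "has_rank j z" "j < k"
proof -
  have "\<exists>j k. has_rank k x \<and> has_rank j z \<and> j < k"
    using assms unfolding adj_below_def by (elim disjE bexE) (force+)
  with that show ?thesis by blast
qed

text \<open>Ranks drop strictly along \<open>adj_below\<close> from at most 3, so either they are 3,
  2, 1 or the lowest is 0.\<close>

lemma adj_below_no_transitive_triangle:
  assumes "adj_below x y" "adj_below y z" "adj_below x z"
  shows False
proof -
  obtain j k where r1: "has_rank k x" "has_rank j y" "j < k" using assms(1) by (rule adj_below_rank)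
  obtain i j' where r2: "has_rank j' y" "has_rank i z" "i < j'" using assms(2) by (rule adj_below_rank)
  have r: "has_rank k x" "has_rank j y" "has_rank i z" "j < k" "i < j"
    using r1 r2 has_rank_unique[OF r1(2) r2(1)] by auto
  have uniq: "has_rank l x \<longleftrightarrow> l = k" "has_rank l y \<longleftrightarrow> l = j" "has_rank l z \<longleftrightarrow> l = i" for l
    using r has_rank_unique by blast+
  have "k \<le> 3" using assms(1) unfolding adj_below_def uniq by auto
  then consider "k = 3" "j = 2" "i = 1" | "i = 0" "j > 0" using r(4,5) by linarith
  then show False
  proof cases
    case 1
    \<comment> \<open>As \<open>z < x < y\<close>, only the alternative of a common
      \<open>rank_up 3\<close> remains; but that of \<open>z\<close> is at most \<open>x\<close>,
      while that of \<open>y\<close> exceeds \<open>x\<close>.\<close>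
    have 2: "x < y" "z < x" "y < z \<or> rank_up 3 z = rank_up 3 y"
      using assms 1 unfolding adj_below_def uniq by simp_all
    have "rank_up 3 z \<le> x" using 2 r(1) 1 by (intro rank_up_least) (auto simp: has_rank_def)
    also have "x < rank_up 3 y" using 2(1) rank_up(2) by (rule less_le_trans)
    finally show False using 2 by (auto dest: less_trans)
  next
    case 2
    \<comment> \<open>A point of rank 0 is joined only to its ancestors, so \<open>y\<close> would
      be a descendant of \<open>x\<close>; no clause joins \<open>x\<close> to a descendant of
      positive rank.\<close>
    have "rank_up k z = x" "rank_up j z = y"
      using assms(2,3) 2 unfolding adj_below_def uniq by auto
    then have eq: "rank_up k y = x" "y \<le> x"
      using rank_up_rank_up[of j k z] r(4) rank_up(2)[of y k] by auto
    then show False using assms(1) 2 r(4) rank_up_rank_up[of 2 3 y]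
      unfolding adj_below_def uniq by auto
  qed
qed

text \<open>Edges point from higher to lower rank, so no triangle is cyclic, and every other
  orientation is transitive.\<close>

lemma adj_no_triangle: "\<not> (adj x y \<and> adj y z \<and> adj x z)"
proof -
  have cyc: False if below: "adj_below a b" "adj_below b c" "adj_below c a" for a b c
  proof -
    obtain i j where 1: "has_rank i a" "has_rank j b" "j < i" using below(1) by (rule adj_below_rank)
    obtain j' k where 2: "has_rank j' b" "has_rank k c" "k < j'" using below(2) by (rule adj_below_rank)
    obtain k' i' where 3: "has_rank k' c" "has_rank i' a" "i' < k'" using below(3) by (rule adj_below_rank)
    show False
      using has_rank_unique[OF 1(1) 3(2)] has_rank_unique[OF 1(2) 2(1)]
        has_rank_unique[OF 2(2) 3(1)] 1(3) 2(3) 3(3) by simp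
  qed
  note no = adj_below_no_transitive_triangle
  show ?thesis unfolding adj_def
    using cyc[of x y z] cyc[of x z y] no[of x y z] no[of x z y] no[of y x z] no[of y z x]
      no[of z x y] no[of z y x] by argo
qed

lemma adj_irrefl: "\<not> adj x x"
  using adj_no_triangle by blast

text \<open>Here \<open>s\<close> and \<open>t\<close> are descendants of the two limit points. One
  of rank 0 is joined to its ancestor; otherwise both ranks are positive, and each remaining
  combination of ranks meets a clause of \<open>adj_below\<close>.\<close>

lemma double_limit_not_independent:
  assumes rk: "has_rank k1 y1" "has_rank k2 y2" "k1 \<in> {1,2,3}" "k2 \<in> {1,2,3}"
    and less: "s < y1" "y1 < t" "t < y2"
    and up: "rank_up k1 s = y1" "rank_up k2 t = y2"
  shows "\<exists>a\<in>{s, y1, t, y2}. \<exists>b\<in>{s, y1, t, y2}. adj a b"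
proof -
  have "s \<notin> limits k1" using rank_up_least[of s k1 s] up(1) less(1) by auto
  then obtain j1 where j1: "j1 < k1" "has_rank j1 s" using ex_has_rank by blast
  have "t \<notin> limits k2" using rank_up_least[of t k2 t] up(2) less(3) by auto
  then obtain j2 where j2: "j2 < k2" "has_rank j2 t" using ex_has_rank by blast
  have up_gt: "rank_up k a \<noteq> b" if "b < a" for a b k
    using less_le_trans[OF that rank_up(2)] by blast
  have "s < t" "s < y2" "y1 < y2" using less by auto
  have "j1 = 0 \<or> j1 = 1 \<or> j1 = 2" "j2 = 0 \<or> j2 = 1 \<or> j2 = 2" using rk(3,4) j1(1) j2(1) by auto
  then consider "j1 = 0" | "j2 = 0" | "k1 = 2" "j1 = 1" "k2 = 2" "j2 = 1" | "k1 = 2" "j1 = 1" "k2 = 3" "j2 = 1"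
    | "k1 = 2" "j1 = 1" "k2 = 3" "j2 = 2" | "k1 = 3" "k2 = 2" | "k1 = 3" "j1 = 1" "k2 = 3"
    | "k1 = 3" "j1 = 2" "k2 = 3" "j2 = 1" | "k1 = 3" "j1 = 2" "k2 = 3" "j2 = 2"
    using rk(3,4) j1(1) j2(1) by auto
  then show ?thesis
  proof cases
    case 1
    then have "adj_below y1 s" using rk j1 up unfolding adj_below_def by blast
    then show ?thesis by (auto simp: adj_def)
  next
    case 2
    then have "adj_below y2 t" using rk j2 up unfolding adj_below_def by blast
    then show ?thesis by (auto simp: adj_def)
  next
    case 3
    then have "adj_below y1 t" using rk j2 up_gt[OF less(2), of 2] less unfolding adj_below_def by simp
    then show ?thesis by (auto simp: adj_def)
  next
    case 4
    then have "adj_below y1 t" using rk j2 up_gt[OF less(2), of 2] less unfolding adj_below_def by simp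
    then show ?thesis by (auto simp: adj_def)
  next
    case 5
    \<comment> \<open>If \<open>rank_up 3 s\<close> is not \<open>y2\<close>, then \<open>y2\<close>
      is joined to \<open>s\<close>. If it is, \<open>s\<close> and \<open>t\<close> share it, and
      the last alternative of \<open>adj_below\<close> joins them.\<close>
    have "adj_below y2 s \<or> adj_below t s"
      using 5 rk j1 j2 up \<open>s < y2\<close> less(2) unfolding adj_below_def by auto
    then show ?thesis by (auto simp: adj_def)
  next
    case 6
    then have "adj_below y1 y2" using rk \<open>y1 < y2\<close> unfolding adj_below_def by simp
    then show ?thesis by (auto simp: adj_def)
  next
    case 7
    then have "adj_below y2 s" using rk j1 up(1) \<open>s < y2\<close> less_imp_neq[OF \<open>y1 < y2\<close>] unfolding adj_below_def by simp
    then show ?thesis by (auto simp: adj_def)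
  next
    case 8
    then have "adj_below s t" using j1 j2 \<open>s < t\<close> up_gt[OF \<open>s < t\<close>, of 2] unfolding adj_below_def by simp
    then show ?thesis by (auto simp: adj_def)
  next
    case 9
    then have "adj_below y1 t" using rk j2 less unfolding adj_below_def by simp
    then show ?thesis by (auto simp: adj_def)
  qed
qed

text \<open>Colour 1 marks the edges of \<open>adj\<close>. A copy has \<open>n\<close> limit
  points, at most \<open>n - 2\<close> of them in \<open>limits 4\<close>; two others, each with a
  close point of its row, contradict \<open>double_limit_not_independent\<close>.\<close>

lemma not_closed_arrow:
  assumes few: "card (limits 4 \<inter> {0<..<\<gamma>}) + 2 \<le> n" "finite (limits 4 \<inter> {0<..<\<gamma>})"
  shows "\<not> closed_arrow \<gamma> (\<omega> * ord_of_nat n + 1) 3"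
proof
  define c :: "cord set \<Rightarrow> nat" where "c e = (if \<exists>x y. e = {x, y} \<and> adj x y then 1 else 0)" for e
  have c: "c {x, y} = 1 \<longleftrightarrow> adj x y" for x y
    using adj_sym by (auto simp: c_def doubleton_eq_iff)
  have pair: "{x, y} \<in> [X]\<^bsup>2\<^esup>" if "x \<in> X" "y \<in> X" "x \<noteq> y" for x y X
    using that by (auto simp: nsets_def)
  assume "closed_arrow \<gamma> (\<omega> * ord_of_nat n + 1) 3"
  moreover have "c \<in> [{..<\<gamma>}]\<^bsup>2\<^esup> \<rightarrow> {0, 1}" by (auto simp: c_def)
  ultimately obtain X where X: "X \<subseteq> {..<\<gamma>}"
    "closed_copy X (\<omega> * ord_of_nat n + 1) \<and> (\<forall>e\<in>[X]\<^bsup>2\<^esup>. c e = 0) \<or>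
     closed_copy X 3 \<and> (\<forall>e\<in>[X]\<^bsup>2\<^esup>. c e = 1)"
    unfolding closed_arrow_def by blast
  from X(2) show False
  proof (elim disjE conjE)
    assume "closed_copy X 3" and 1: "\<forall>e\<in>[X]\<^bsup>2\<^esup>. c e = 1"
    then have "card X = 3" by (intro card_closed_copy_3)
    then obtain x y z where "X = {x, y, z}" "x \<noteq> y" "x \<noteq> z" "y \<noteq> z"
      by (auto simp: card_3_iff)
    then have "c {x, y} = 1" "c {y, z} = 1" "c {x, z} = 1" by (intro 1[rule_format] pair; simp)+
    then have "adj x y" "adj y z" "adj x z" unfolding c by auto
    then show False using adj_no_triangle by blast
  next
    assume cc: "closed_copy X (\<omega> * ord_of_nat n + 1)" and 0: "\<forall>e\<in>[X]\<^bsup>2\<^esup>. c e = 0"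
    have indep: "\<not> adj x y" if "x \<in> X" "y \<in> X" for x y
      using 0 pair[OF that] c[of x y] adj_irrefl by (cases "x = y") auto
    obtain w where "\<forall>i<n. \<forall>t. w i t \<in> X" "w n 0 \<in> X" "\<forall>i<n. \<forall>t. w i t < w (Suc i) (0 :: nat)"
      "\<forall>i<n. \<forall>p<w (Suc i) 0. \<exists>t. p < w i t"
      using closed_copy_omega_timesD[OF cc] by (elim exE conjE) (rule that)
    note w = this[rule_format]
    \<comment> \<open>\<open>y i\<close> is the limit of row \<open>i\<close>; the first entry of
      row 0 is left out.\<close>
    define y where "y i = w (Suc i) 0" for i
    have yX: "y i \<in> X" if "i < n" for i
      using that w(1,2) unfolding y_def by (cases "Suc i = n") auto
    have y_Suc: "y i < y (Suc i)" if "Suc i < n" for i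
      using w(3)[OF that] unfolding y_def .
    have y_mono: "y i < y j" if "i < j" "j < n" for i j
      using that
    proof (induction j)
      case (Suc j)
      then show ?case using y_Suc[of j] by (cases "i = j") (auto intro: less_trans)
    qed simp
    have inj: "inj_on y {..<n}"
      by (rule inj_onI) (metis lessThan_iff less_irrefl linorder_neqE_nat y_mono)
    let ?H = "{i. i < n \<and> y i \<in> limits 4}"
    have "y ` ?H \<subseteq> limits 4 \<inter> {0<..<\<gamma>}"
    proof -
      have "0 < y i" if "i < n" for i
        using le_less_trans[OF zero_le_cord w(3)[OF that]] unfolding y_def .
      then show ?thesis using yX X(1) by (auto simp: subset_iff)
    qed
    then have "card (y ` ?H) \<le> card (limits 4 \<inter> {0<..<\<gamma>})" by (rule card_mono[OF few(2)])
    moreover have "card (y ` ?H) = card ?H"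
      by (rule card_image) (rule inj_on_subset[OF inj], auto)
    moreover have "card {..<n} = card ?H + card ({..<n} - ?H)"
      using card_Diff_subset[of ?H "{..<n}"] card_mono[of "{..<n}" ?H] by fastforce
    ultimately have "2 \<le> card ({..<n} - ?H)" using few(1) by simp
    then obtain i j where ij: "i < j" "j < n" "y i \<notin> limits 4" "y j \<notin> limits 4"
    proof -
      assume 2: "2 \<le> card ({..<n} - ?H)" and *: "\<And>i j. i < j \<Longrightarrow> j < n \<Longrightarrow> y i \<notin> limits 4 \<Longrightarrow> y j \<notin> limits 4 \<Longrightarrow> thesis"
      obtain S where "S \<subseteq> {..<n} - ?H" "card S = 2" using obtain_subset_with_card_n[OF 2] by metis
      then obtain i j where "i \<in> {..<n} - ?H" "j \<in> {..<n} - ?H" "i \<noteq> j" by (auto simp: card_2_iff)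
      then show thesis using *[of i j] *[of j i] by (cases i j rule: linorder_cases) auto
    qed
    have rank: "\<exists>k\<in>{1,2,3}. has_rank k (y l)" if l: "l < n" "y l \<notin> limits 4" for l
    proof -
      obtain k where k: "k < 4" "has_rank k (y l)" using ex_has_rank[OF l(2)] by blast
      have "\<exists>x. p < x \<and> x < y l" if "p < y l" for p
        using w(3,4) \<open>l < n\<close> that unfolding y_def by blast
      then have "y l \<in> limits (Suc 0)" by simp
      then have "k \<noteq> 0" using k(2) unfolding has_rank_def by (metis)
      then have "k \<in> {1,2,3}" using k(1) by auto
      then show ?thesis using k(2) by blast
    qed
    have near: "\<exists>t. rank_up k (w l t) = y l \<and> q < w l t" if l: "has_rank k (y l)" "l < n" "q < y l" for k l q
    proof -
      obtain p where p: "p < y l" "\<And>x. p < x \<Longrightarrow> x \<le> y l \<Longrightarrow> rank_up k x = y l"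
        using rank_up_eq_near[OF l(1)] by metis
      then have "max p q < w (Suc l) 0" using that(3) by (simp add: y_def)
      then obtain t where "max p q < w l t" using w(4) l(2) by blast
      then have "q < w l t" "rank_up k (w l t) = y l"
        using p(2)[of "w l t"] w(3)[OF l(2), of t] by (simp_all add: y_def)
      then show ?thesis by blast
    qed
    obtain k1 where k1: "k1 \<in> {1,2,3}" "has_rank k1 (y i)" using rank ij by (meson less_trans)
    obtain k2 where k2: "k2 \<in> {1,2,3}" "has_rank k2 (y j)" using rank ij by meson
    have "i < n" using ij by simp
    have "w i 0 < y i" using w(3) \<open>i < n\<close> by (simp add: y_def)
    then obtain a where a: "rank_up k1 (w i a) = y i" using near[OF k1(2) \<open>i < n\<close>] by blast
    \<comment> \<open>The point below \<open>y j\<close> is taken beyond \<open>y i\<close>, so that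
      the four points interleave.\<close>
    obtain b where b: "rank_up k2 (w j b) = y j" "y i < w j b"
      using near[OF k2(2) ij(2) y_mono[OF ij(1,2)]] by blast
    have "\<exists>a'\<in>{w i a, y i, w j b, y j}. \<exists>b'\<in>{w i a, y i, w j b, y j}. adj a' b'"
      using k1 k2 a b w(3) ij(2) \<open>i < n\<close>
      by (intro double_limit_not_independent) (auto simp: y_def)
    moreover have "{w i a, y i, w j b, y j} \<subseteq> X" using w(1) yX ij(2) \<open>i < n\<close> by simp
    ultimately show False using indep by blast
  qed
qed

text \<open>The summand 1 admits the top multiple \<open>\<omega> ^ 4 * ord_of_nat m\<close>; with 0
  excluded, at most \<open>m\<close> points remain.\<close>

lemma limits_4_below:
  "limits 4 \<inter> {0<..<\<omega> ^ 4 * ord_of_nat m + 1} \<subseteq> (\<lambda>i. \<omega> ^ 4 * ord_of_nat i) ` {1..m}"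
proof
  fix y assume y: "y \<in> limits 4 \<inter> {0<..<\<omega> ^ 4 * ord_of_nat m + 1}"
  then obtain b where b: "y = \<omega> ^ 4 * b" using limits_multiples by blast
  have "\<not> ord_of_nat m < b"
    using y times_cord_strict_mono[OF omega_power_pos[of 4], of "ord_of_nat m" b]
    by (auto simp: b less_plus_one_cord_iff)
  then have "b < ord_of_nat (Suc m)" by (simp add: less_plus_one_cord_iff)
  then obtain i where i: "b = ord_of_nat i" "i < Suc m" by (rule less_ord_of_natE)
  have "i \<noteq> 0" using y by (cases "i = 0") (auto simp: b i times_cord_zero)
  then show "y \<in> (\<lambda>i. \<omega> ^ 4 * ord_of_nat i) ` {1..m}" using i b by auto
qed

lemma not_closed_arrow_omega_4_times:
  assumes "m + 2 \<le> n"
  shows "\<not> closed_arrow (\<omega> ^ 4 * ord_of_nat m + 1) (\<omega> * ord_of_nat n + 1) 3"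
proof (rule not_closed_arrow)
  let ?I = "(\<lambda>i. \<omega> ^ 4 * ord_of_nat i) ` {1..m}"
  have "card ?I \<le> m" using card_image_le[of "{1..m}"] by simp
  then show "card (limits 4 \<inter> {0<..<\<omega> ^ 4 * ord_of_nat m + 1}) + 2 \<le> n"
    using card_mono[OF _ limits_4_below[of m]] assms by fastforce
  show "finite (limits 4 \<inter> {0<..<\<omega> ^ 4 * ord_of_nat m + 1})"
    using limits_4_below by (rule finite_subset) simp
qed

text \<open>No nonzero multiple of \<open>\<omega> ^ 4\<close> lies below
  \<open>\<omega> ^ 4\<close>, so the count in \<open>not_closed_arrow\<close> is 0.\<close>

lemma not_closed_arrow_omega_4: "\<not> closed_arrow (\<omega> ^ 4) (\<omega> * 2 + 1) 3"
proof -
  have "limits 4 \<inter> {0<..<\<omega> ^ 4} = {}"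
  proof (rule ccontr)
    assume "\<not> ?thesis"
    then obtain b where "0 < \<omega> ^ 4 * b" "\<omega> ^ 4 * b < \<omega> ^ 4 * 1" using limits_multiples by fastforce
    then show False
      by (simp add: times_cord_less_iff[OF omega_power_pos] less_one_cord_iff times_cord_zero del: mult_1_right)
  qed
  then show ?thesis
    using not_closed_arrow[of "\<omega> ^ 4" 2] by (simp add: ord_of_nat_numeral del: limits.simps)
qed

section \<open>From arrow relations to bounds on the least ordinal\<close>

lemma closed_arrow_mono:
  assumes "closed_arrow \<gamma> \<alpha> \<beta>" "\<gamma> \<le> \<delta>"
  shows "closed_arrow \<delta> \<alpha> \<beta>"
  unfolding closed_arrow_def
proof
  fix c assume c: "c \<in> [{..<\<delta>}]\<^bsup>2\<^esup> \<rightarrow> {0, 1 :: nat}"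
  have sub: "{..<\<gamma>} \<subseteq> {..<\<delta>}" using assms(2) by auto
  then have "c \<in> [{..<\<gamma>}]\<^bsup>2\<^esup> \<rightarrow> {0, 1}" using c nsets_mono by blast
  then show "\<exists>X\<subseteq>{..<\<delta>}. closed_copy X \<alpha> \<and> (\<forall>e\<in>[X]\<^bsup>2\<^esup>. c e = 0) \<or>
      closed_copy X \<beta> \<and> (\<forall>e\<in>[X]\<^bsup>2\<^esup>. c e = 1)"
    using assms(1) sub unfolding closed_arrow_def by (meson order_trans)
qed

lemma closed_Ramsey_bounds:
  assumes "closed_arrow \<gamma> \<alpha> \<beta>" "\<not> closed_arrow \<delta> \<alpha> \<beta>"
  shows "\<delta> < closed_Ramsey \<alpha> \<beta>" "closed_Ramsey \<alpha> \<beta> \<le> \<gamma>"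
proof -
  show "closed_Ramsey \<alpha> \<beta> \<le> \<gamma>" unfolding closed_Ramsey_def using assms(1) by (rule Least_le)
  have "closed_arrow (closed_Ramsey \<alpha> \<beta>) \<alpha> \<beta>"
    unfolding closed_Ramsey_def using assms(1) by (rule LeastI)
  then show "\<delta> < closed_Ramsey \<alpha> \<beta>" using closed_arrow_mono assms(2) by (meson not_less)
qed

section \<open>The upper bound\<close>

definition is_ultra :: "'a filter \<Rightarrow> bool" where
  "is_ultra F \<longleftrightarrow> F \<noteq> bot \<and> (\<forall>P. eventually P F \<or> eventually (\<lambda>x. \<not> P x) F)"

lemma is_ultra_not_eventually: "is_ultra F \<Longrightarrow> \<not> eventually P F \<Longrightarrow> eventually (\<lambda>x. \<not> P x) F"
  by (auto simp: is_ultra_def)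

text \<open>Zorn's lemma for a minimal proper filter: the infimum of a chain of proper filters is
  proper. If the complement of \<open>P\<close> is not large for a minimal \<open>U\<close>,
  restricting \<open>U\<close> to \<open>P\<close> stays proper and hence changes nothing.\<close>

lemma ex_finer_ultrafilter:
  fixes F :: "'a filter"
  assumes "F \<noteq> bot"
  shows "\<exists>U\<le>F. is_ultra U"
proof -
  let ?A = "{G. G \<noteq> bot \<and> G \<le> F}" and ?P = "\<lambda>G H :: 'a filter. H \<le> G"
  have "\<exists>m\<in>?A. \<forall>a\<in>?A. ?P m a \<longrightarrow> a = m"
  proof (rule predicate_Zorn)
    show "partial_order_on ?A (relation_of ?P ?A)"
      by (rule partial_order_on_relation_ofI) auto
    fix C assume "C \<in> Chains (relation_of ?P ?A)"
    then have C: "C \<subseteq> ?A" and chain: "\<And>G H. G \<in> C \<Longrightarrow> H \<in> C \<Longrightarrow> G \<le> H \<or> H \<le> G"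
      by (auto simp: Chains_def relation_of_def)
    show "\<exists>u\<in>?A. \<forall>a\<in>C. ?P a u"
    proof (cases "C = {}")
      case True
      then show ?thesis using assms by auto
    next
      case False
      have "eventually Q (Inf C) \<longleftrightarrow> (\<exists>G\<in>C. eventually Q G)" for Q
      proof (rule eventually_Inf_base[OF False])
        fix G H assume "G \<in> C" "H \<in> C"
        then show "\<exists>x\<in>C. x \<le> inf G H" using chain[of G H] by (metis inf.absorb1 inf.absorb2 order_refl)
      qed
      then have "Inf C \<noteq> bot" using C by (auto simp: trivial_limit_def)
      moreover have "Inf C \<le> F" using False C by (auto intro: Inf_lower2)
      ultimately show ?thesis by (auto intro: Inf_lower)
    qed
  qed
  then obtain U where U: "U \<noteq> bot" "U \<le> F" and min: "\<And>G. G \<noteq> bot \<Longrightarrow> G \<le> U \<Longrightarrow> G = U"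
    using order_trans by blast
  have "eventually P U" if "\<not> eventually (\<lambda>x. \<not> P x) U" for P
  proof -
    have "inf U (principal {x. P x}) = U"
      using that by (intro min) (auto simp: trivial_limit_def eventually_inf_principal)
    then have "U \<le> principal {x. P x}" by (metis inf.cobounded2)
    then show ?thesis by (simp add: le_principal)
  qed
  then have "is_ultra U" using U(1) by (auto simp: is_ultra_def)
  with U(2) show ?thesis by blast
qed

text \<open>For ultrafilters this is the sum of the family \<open>G\<close> along \<open>F\<close>,
  an iterated limit.\<close>

definition bind_filter :: "'a filter \<Rightarrow> ('a \<Rightarrow> 'b filter) \<Rightarrow> 'b filter" where
  "bind_filter F G = Abs_filter (\<lambda>P. eventually (\<lambda>x. eventually P (G x)) F)"

lemma eventually_bind_filter:
  fixes G :: "'a \<Rightarrow> 'b filter"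
  shows "eventually P (bind_filter F G) \<longleftrightarrow> eventually (\<lambda>x. eventually P (G x)) F"
  unfolding bind_filter_def
proof (rule eventually_Abs_filter, unfold_locales)
  fix P Q :: "'b \<Rightarrow> bool"
  show "\<forall>\<^sub>F x in F. \<forall>\<^sub>F x in G x. True" by simp
  show "\<forall>\<^sub>F x in F. eventually P (G x) \<Longrightarrow> \<forall>\<^sub>F x in F. eventually Q (G x) \<Longrightarrow>
      \<forall>\<^sub>F x in F. \<forall>\<^sub>F x in G x. P x \<and> Q x"
    by (simp add: eventually_conj_iff)
  show "\<forall>x. P x \<longrightarrow> Q x \<Longrightarrow> \<forall>\<^sub>F x in F. eventually P (G x) \<Longrightarrow> \<forall>\<^sub>F x in F. eventually Q (G x)"
    by (auto elim!: eventually_mono)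
qed

lemma is_ultra_bind_filter:
  assumes "is_ultra F" "\<And>x. is_ultra (G x)"
  shows "is_ultra (bind_filter F G)"
  unfolding is_ultra_def
proof (intro conjI allI)
  have "\<not> eventually (\<lambda>x. False) (G x)" for x using assms(2) by (auto simp: is_ultra_def trivial_limit_def)
  then show "bind_filter F G \<noteq> bot"
    using assms(1) by (simp add: trivial_limit_def eventually_bind_filter is_ultra_def)
  show "eventually P (bind_filter F G) \<or> (\<forall>\<^sub>F x in bind_filter F G. \<not> P x)" for P
    unfolding eventually_bind_filter
  proof (subst disj_commute, rule disjCI)
    assume "\<not> (\<forall>\<^sub>F x in F. eventually P (G x))"
    then have "\<forall>\<^sub>F x in F. \<not> eventually P (G x)" by (rule is_ultra_not_eventually[OF assms(1)])
    then show "\<forall>\<^sub>F x in F. \<forall>\<^sub>F x in G x. \<not> P x"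
      by (rule eventually_mono) (rule is_ultra_not_eventually[OF assms(2)])
  qed
qed

lemma is_ultra_filtermap: "is_ultra F \<Longrightarrow> is_ultra (filtermap f F)"
  by (auto simp: is_ultra_def eventually_filtermap filtermap_bot_iff)

definition nat_ultra :: "nat filter" where
  "nat_ultra = (SOME U. U \<le> sequentially \<and> is_ultra U)"

lemma nat_ultra: "nat_ultra \<le> sequentially" "is_ultra nat_ultra"
proof -
  have "nat_ultra \<le> sequentially \<and> is_ultra nat_ultra"
    unfolding nat_ultra_def using ex_finer_ultrafilter[OF sequentially_bot] by (rule someI_ex)
  then show "nat_ultra \<le> sequentially" "is_ultra nat_ultra" by auto
qed

section \<open>Filters of points of a given rank\<close>

text \<open>\<open>bases j d \<beta>\<close> concentrates on the \<open>b\<close> such that \<open>b + \<omega> ^ j\<close> is a point of rank \<open>j\<close> below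
  \<open>\<beta> + \<omega> ^ (j + d)\<close>; \<open>points j d \<beta>\<close> below is the corresponding filter on the points themselves.\<close>

primrec bases :: "nat \<Rightarrow> nat \<Rightarrow> cord \<Rightarrow> cord filter" where
  "bases j 0 \<beta> = principal {\<beta>}"
| "bases j (Suc d) \<beta> = bind_filter nat_ultra (\<lambda>t. bases j d (\<beta> + \<omega> ^ (j + d) * ord_of_nat t))"

lemma is_ultra_bases: "is_ultra (bases j d \<beta>)"
proof (induction d arbitrary: \<beta>)
  case 0
  show ?case by (auto simp: is_ultra_def eventually_principal principal_eq_bot_iff)
qed (simp add: is_ultra_bind_filter nat_ultra)

text \<open>A base for rank \<open>i\<close> is chosen in two stages, first one for rank
  \<open>i + e\<close> and then one beneath it; this links the filters of two ranks.\<close>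

lemma eventually_bases_add:
  "eventually P (bases i (e + d) \<beta>) \<longleftrightarrow>
   eventually (\<lambda>b. eventually P (bases i e b)) (bases (i + e) d \<beta>)"
proof (induction d arbitrary: \<beta>)
  case 0
  show ?case by (simp add: eventually_principal)
qed (simp add: eventually_bind_filter add.assoc)

lemma omega_power_times_Suc_less:
  "\<beta> + \<omega> ^ k * ord_of_nat t + \<omega> ^ k < \<beta> + \<omega> ^ Suc k"
proof -
  have "\<beta> + \<omega> ^ k * ord_of_nat t + \<omega> ^ k = \<beta> + \<omega> ^ k * ord_of_nat (Suc t)"
    by (simp add: times_cord_plus add.assoc)
  also have "\<dots> < \<beta> + \<omega> ^ k * \<omega>"
    by (intro plus_cord_strict_mono times_cord_strict_mono omega_power_pos ord_of_nat_less_omega)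
  finally show ?thesis by (simp only: power_Suc2)
qed

lemma bases_within: "eventually (\<lambda>b. \<beta> \<le> b \<and> b + \<omega> ^ j \<le> \<beta> + \<omega> ^ (j + d)) (bases j d \<beta>)"
proof (induction d arbitrary: \<beta>)
  case 0
  show ?case by (simp add: eventually_principal)
next
  case (Suc d)
  show ?case unfolding bases.simps eventually_bind_filter
  proof (rule always_eventually, rule allI)
    fix t
    let ?b = "\<beta> + \<omega> ^ (j + d) * ord_of_nat t"
    show "eventually (\<lambda>b. \<beta> \<le> b \<and> b + \<omega> ^ j \<le> \<beta> + \<omega> ^ (j + Suc d)) (bases j d ?b)"
      using Suc[of ?b]
    proof (rule eventually_mono)
      fix b assume b: "?b \<le> b \<and> b + \<omega> ^ j \<le> ?b + \<omega> ^ (j + d)"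
      have "\<beta> \<le> b" using b le_plus_cord order_trans by blast
      moreover have "b + \<omega> ^ j \<le> \<beta> + \<omega> ^ (j + Suc d)"
        using b omega_power_times_Suc_less[of \<beta> "j + d" t] by auto
      ultimately show "\<beta> \<le> b \<and> b + \<omega> ^ j \<le> \<beta> + \<omega> ^ (j + Suc d)" ..
    qed
  qed
qed

definition points :: "nat \<Rightarrow> nat \<Rightarrow> cord \<Rightarrow> cord filter" where
  "points j d \<beta> = filtermap (\<lambda>b. b + \<omega> ^ j) (bases j d \<beta>)"

lemma is_ultra_points: "is_ultra (points j d \<beta>)"
  unfolding points_def by (intro is_ultra_filtermap is_ultra_bases)

text \<open>Any \<open>p\<close> below the top is passed by adding to \<open>\<beta>\<close> a
  finite multiple of the preceding power of \<omega>, and the outermost ultrafilter ignores finitely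
  many multiples. For \<open>d = 0\<close> the filter is principal at the top itself.\<close>

lemma points_near:
  assumes "0 < d" "p < \<beta> + \<omega> ^ (j + d)"
  shows "eventually (\<lambda>x. p < x \<and> x < \<beta> + \<omega> ^ (j + d)) (points j d \<beta>)"
proof -
  obtain e where d: "d = Suc e" using assms(1) by (cases d) auto
  let ?q = "\<omega> ^ (j + e)"
  have "p < \<beta> + ?q * \<omega>" using assms(2) by (simp add: d power_Suc2 del: power_Suc)
  then obtain t0 where t0: "p < \<beta> + ?q * ord_of_nat t0"
  proof (cases rule: less_plus_cordE)
    case 1
    then show ?thesis using that[of 0] by (simp add: times_cord_zero)
  next
    case (2 x)
    obtain r where r: "r < \<omega>" "x < ?q * r + ?q" using 2(1) by (rule less_times_cordE)
    obtain t where "r = ord_of_nat t" using r(1) lessThan_omega by blast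
    then have "x < ?q * ord_of_nat (Suc t)" using r(2) by (simp add: times_cord_plus)
    then have "p < \<beta> + ?q * ord_of_nat (Suc t)" using 2(2) plus_cord_strict_mono le_less_trans by blast
    then show ?thesis by (rule that)
  qed
  have "eventually (\<lambda>t. t0 \<le> t) nat_ultra"
    using nat_ultra(1) eventually_ge_at_top filter_leD by blast
  then show ?thesis unfolding points_def d eventually_filtermap bases.simps eventually_bind_filter
  proof (rule eventually_mono)
    fix t assume t: "t0 \<le> t"
    let ?b = "\<beta> + ?q * ord_of_nat t"
    show "eventually (\<lambda>b. p < b + \<omega> ^ j \<and> b + \<omega> ^ j < \<beta> + \<omega> ^ (j + Suc e)) (bases j e ?b)"
      using bases_within[of ?b j e]
    proof (rule eventually_mono)
      fix b assume b: "?b \<le> b \<and> b + \<omega> ^ j \<le> ?b + \<omega> ^ (j + e)"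
      have "p < \<beta> + ?q * ord_of_nat t0" by (rule t0)
      also have "\<dots> \<le> ?b" using t by (intro plus_cord_mono times_cord_mono) simp
      also have "\<dots> \<le> b" using b by simp
      also have "\<dots> \<le> b + \<omega> ^ j" by (rule le_plus_cord)
      finally have "p < b + \<omega> ^ j" .
      moreover have "b + \<omega> ^ j < \<beta> + \<omega> ^ (j + Suc e)"
        using b omega_power_times_Suc_less[of \<beta> "j + e" t] by auto
      ultimately show "p < b + \<omega> ^ j \<and> b + \<omega> ^ j < \<beta> + \<omega> ^ (j + Suc e)" ..
    qed
  qed
qed

section \<open>Closed copies from converging filters\<close>

text \<open>Points are chosen by recursion, cycling through the rows. Each choice faces finitely
  many demands, all met by \<open>F i\<close>-most points; the \<open>y i\<close> become the limit
  points.\<close>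

lemma independent_closed_copy:
  fixes F :: "nat \<Rightarrow> cord filter" and y :: "nat \<Rightarrow> cord" and E :: "cord \<Rightarrow> cord \<Rightarrow> bool"
  assumes n: "0 < n"
    and sym: "\<And>x z. E x z \<Longrightarrow> E z x"
    and nontriv: "\<And>i. i < n \<Longrightarrow> F i \<noteq> bot"
    and pos: "\<And>i. i < n \<Longrightarrow> 0 < y i"
    and near: "\<And>i p. i < n \<Longrightarrow> p < y i \<Longrightarrow> eventually (\<lambda>x. p < x \<and> x < y i) (F i)"
    and mono: "\<And>i j. i < j \<Longrightarrow> j < n \<Longrightarrow> y i < y j"
    and PF: "\<And>i. i < n \<Longrightarrow> eventually P (F i)" and Py: "\<And>i. i < n \<Longrightarrow> P (y i)"
    and yy: "\<And>i j. i < n \<Longrightarrow> j < n \<Longrightarrow> i \<noteq> j \<Longrightarrow> \<not> E (y i) (y j)"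
    and Fy: "\<And>i j. i < n \<Longrightarrow> j < n \<Longrightarrow> eventually (\<lambda>x. \<not> E (y i) x) (F j)"
    and FF: "\<And>i j. i < n \<Longrightarrow> j < n \<Longrightarrow> eventually (\<lambda>x. eventually (\<lambda>z. \<not> E x z) (F j)) (F i)"
  shows "\<exists>X. closed_copy X (\<omega> * ord_of_nat n + 1) \<and> (\<forall>x\<in>X. P x) \<and>
    (\<forall>a\<in>X. \<forall>b\<in>X. a \<noteq> b \<longrightarrow> \<not> E a b)"
proof -
  \<comment> \<open>Enumerating the ordinals below \<open>y i\<close> lets row \<open>i\<close>
    exceed each of them and so converge to \<open>y i\<close>.\<close>
  define q where "q i = from_nat_into {..<y i}" for i
  have q: "range (q i) = {..<y i}" if "i < n" for i
    unfolding q_def using pos[OF that] by (intro range_from_nat_into countable_lessThan_cord) auto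
  \<comment> \<open>The last conjunct is a promise for later stages: most candidates for each row
    are not joined to \<open>x\<close>.\<close>
  define good where "good x \<longleftrightarrow> P x \<and> (\<forall>j<n. \<not> E (y j) x) \<and> (\<forall>j<n. eventually (\<lambda>z. \<not> E x z) (F j))" for x
  \<comment> \<open>Stage \<open>s\<close> serves row \<open>s mod n\<close> and must exceed the
    bound with number \<open>s div n\<close>.\<close>
  define R where "R f s r \<longleftrightarrow> good r \<and> r < y (s mod n) \<and> q (s mod n) (s div n) < r \<and>
      (\<forall>u<s. \<not> E (f u) r \<and> (f u < y (s mod n) \<longrightarrow> f u < r)) \<and>
      (\<forall>j<s mod n. y j < r)" for f s r
  have "\<exists>f. \<forall>s. R f s (f s)"
  proof (rule dependent_wellorder_choice)
    show "R f s r = R g s r" if "\<And>u. u < s \<Longrightarrow> f u = g u" for r f g s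
      using that by (simp add: R_def)
    fix s f assume prev: "\<And>u. u < s \<Longrightarrow> R f u (f u)"
    define i where "i = s mod n"
    have i: "i < n" using n by (simp add: i_def)
    have "eventually (\<lambda>r. \<forall>j\<in>{..<n}. \<not> E (y j) r) (F i)"
      using Fy i by (intro eventually_ball_finite) auto
    moreover have "eventually (\<lambda>r. \<forall>j\<in>{..<n}. eventually (\<lambda>z. \<not> E r z) (F j)) (F i)"
      using FF i by (intro eventually_ball_finite) auto
    moreover have "eventually (\<lambda>r. \<forall>u\<in>{..<s}. \<not> E (f u) r) (F i)"
      using prev i by (intro eventually_ball_finite) (auto simp: R_def good_def)
    moreover have "eventually (\<lambda>r. \<forall>u\<in>{..<s}. f u < y i \<longrightarrow> f u < r) (F i)"
    proof (intro eventually_ball_finite ballI)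
      show "eventually (\<lambda>r. f u < y i \<longrightarrow> f u < r) (F i)" for u
        using near[OF i, of "f u"] by (cases "f u < y i") (auto elim: eventually_mono)
    qed simp
    moreover have "eventually (\<lambda>r. \<forall>j\<in>{..<i}. y j < r) (F i)"
    proof (intro eventually_ball_finite ballI)
      show "eventually (\<lambda>r. y j < r) (F i)" if "j \<in> {..<i}" for j
        using near[OF i, of "y j"] mono[of j i] i that by (auto elim: eventually_mono)
    qed simp
    moreover have "q i (s div n) < y i" using q[OF i] by blast
    then have "eventually (\<lambda>r. q i (s div n) < r \<and> r < y i) (F i)" by (rule near[OF i])
    moreover note PF[OF i]
    ultimately have "eventually (\<lambda>r. R f s r) (F i)"
      by eventually_elim (simp add: R_def good_def i_def[symmetric])
    then show "\<exists>r. R f s r" using nontriv[OF i] eventually_happens by blast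
  qed
  then obtain f where f: "R f s (f s)" for s by blast
  define x where "x i t = f (t * n + i)" for i t
  have x: "good (x i t)" "x i t < y i" "q i t < x i t" "\<And>j. j < i \<Longrightarrow> y j < x i t"
    if "i < n" for i t
    using f[of "t * n + i"] that by (auto simp: R_def x_def)
  have x_step: "x i t < x i (Suc t)" if "i < n" for i t
  proof -
    have "(Suc t * n + i) mod n = i" using that using mod_mult_self3[of "Suc t" n i] by (simp del: mult_Suc)
    then show ?thesis
      using f[of "Suc t * n + i"] x(2)[OF that, of t] n by (simp add: R_def x_def)
  qed
  \<comment> \<open>In each row after the first, column 0 is overwritten by the limit of the
    preceding row.\<close>
  define w where "w i t = (if t = 0 \<and> 0 < i then y (i - 1) else x i t)" for i t
  let ?X = "{w i t |i t. i < n} \<union> {w n 0}"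
  have cc: "closed_copy ?X (\<omega> * ord_of_nat n + 1)"
  proof (rule closed_copy_omega_timesI)
    fix i t assume i: "i < n"
    show "w i t < w i (Suc t)" using i x_step x(4) by (auto simp: w_def)
    show "w i t < w (Suc i) 0" using i x(2) mono[of "i - 1" i] by (auto simp: w_def)
  next
    fix i p assume i: "i < n" and "p < w (Suc i) 0"
    then have "p \<in> range (q i)" using q by (simp add: w_def)
    then obtain t where "p = q i t" by blast
    then have "p < x i t" using x(3)[OF i] by simp
    \<comment> \<open>Column \<open>Suc t\<close> is used because column 0 may be
      overwritten.\<close>
    also have "\<dots> < w i (Suc t)" using x_step[OF i] by (simp add: w_def)
    finally show "\<exists>t. p < w i t" by blast
  qed
  have X: "?X \<subseteq> range f \<union> y ` {..<n}"
    using n by (auto simp: w_def x_def)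
  have good_f: "good (f s)" for s using f[of s] by (simp add: R_def)
  have "P a" if "a \<in> range f \<union> y ` {..<n}" for a
    using that good_f Py unfolding good_def by blast
  then have PX: "\<forall>a\<in>?X. P a" using X by blast
  have ff: "\<not> E (f u) (f s)" if "f u \<noteq> f s" for u s
  proof (cases u s rule: linorder_cases)
    case less
    then show ?thesis using f[of s] by (simp add: R_def)
  next
    case greater
    then have "\<not> E (f s) (f u)" using f[of u] by (simp add: R_def)
    then show ?thesis using sym by blast
  qed (use that in simp)
  have fy: "\<not> E (y j) (f s)" if "j < n" for j s using good_f that by (simp add: good_def)
  have noE: "\<not> E a b" if ab: "a \<in> range f \<union> y ` {..<n}" "b \<in> range f \<union> y ` {..<n}" "a \<noteq> b" for a b
    using ab
  proof (elim UnE imageE; hypsubst_thin)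
    show "f u \<noteq> f s \<Longrightarrow> \<not> E (f u) (f s)" for u s by (rule ff)
    show "j \<in> {..<n} \<Longrightarrow> \<not> E (f u) (y j)" for u j using fy sym by blast
    show "j \<in> {..<n} \<Longrightarrow> \<not> E (y j) (f u)" for u j using fy by blast
    show "i \<in> {..<n} \<Longrightarrow> j \<in> {..<n} \<Longrightarrow> y i \<noteq> y j \<Longrightarrow> \<not> E (y i) (y j)" for i j
      using yy by (metis lessThan_iff)
  qed
  have "\<forall>a\<in>?X. \<forall>b\<in>?X. a \<noteq> b \<longrightarrow> \<not> E a b"
    by (intro ballI impI) (rule noE[OF subsetD[OF X] subsetD[OF X]])
  with cc PX show ?thesis by (intro exI[of _ ?X] conjI)
qed

section \<open>Ramsey's theorem and triangle-free graphs\<close>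

text \<open>The finite Ramsey theorem is applied to two-element sets coloured by
  \<open>f (Min S) (Max S)\<close>, with the colours numbered by \<open>e\<close>. The bound
  \<open>N\<close> depends only on \<open>K\<close> and \<open>m\<close>.\<close>

lemma ramsey_pairs:
  fixes K :: "'c set" and m :: nat
  assumes "finite K"
  shows "\<exists>N. \<forall>f. (\<forall>a b. f a b \<in> K) \<longrightarrow> (\<exists>h c. (\<forall>i<m. h i < N) \<and>
    (\<forall>i j. i < j \<and> j < m \<longrightarrow> h i < h j \<and> f (h i :: nat) (h j) = c))"
proof -
  define k where "k = card K"
  obtain e where e: "bij_betw e K {..<k}"
    using ex_bij_betw_finite_nat[OF assms] unfolding k_def atLeast0LessThan by blast
  obtain N :: nat where N: "partn_lst {..<N} (replicate k m) 2" using ramsey_full by blast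
  show ?thesis
  proof (intro exI[of _ N] allI impI)
    fix f :: "nat \<Rightarrow> nat \<Rightarrow> 'c" assume f: "\<forall>a b. f a b \<in> K"
    define g where "g S = e (f (Min S) (Max S))" for S
    have "g \<in> [{..<N}]\<^bsup>2\<^esup> \<rightarrow> {..<length (replicate k m)}"
      using e f by (auto simp: g_def bij_betw_def)
    then obtain c where c: "c < k" "monochromatic {..<N} m 2 g c"
      using N[unfolded partn_lst_def, rule_format] by force
    then obtain H where H: "H \<in> [{..<N}]\<^bsup>m\<^esup>" "g ` [H]\<^bsup>2\<^esup> \<subseteq> {c}"
      unfolding monochromatic_def by blast
    then have fin: "finite H" "card H = m" "H \<subseteq> {..<N}" by (auto simp: nsets_def)
    define h where "h = (!) (sorted_list_of_set H)"
    have hH: "h i \<in> H" if "i < m" for i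
      using that fin nth_mem[of i "sorted_list_of_set H"] by (simp add: h_def)
    have h_mono: "h i < h j" if "i < j" "j < m" for i j
      using that fin sorted_wrt_nth_less[OF strict_sorted_list_of_set[of H]] by (simp add: h_def)
    obtain d where d: "d \<in> K" "e d = c" using e c(1) unfolding bij_betw_def by (metis imageE lessThan_iff)
    have "f (h i) (h j) = d" if "i < j" "j < m" for i j
    proof -
      have lt: "h i < h j" using that by (rule h_mono)
      then have "{h i, h j} \<in> [H]\<^bsup>2\<^esup>" using hH that by (auto simp: nsets_def)
      then have "g {h i, h j} = c" using H(2) by blast
      then have "e (f (h i) (h j)) = e d" using lt d by (simp add: g_def)
      then show ?thesis using inj_onD[OF bij_betw_imp_inj_on[OF e]] f d(1) by blast
    qed
    then show "\<exists>h c. (\<forall>i<m. h i < N) \<and> (\<forall>i j. i < j \<and> j < m \<longrightarrow> h i < h j \<and> f (h i) (h j) = c)"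
      using hH h_mono fin(3) by (intro exI[of _ h] exI[of _ d]) (auto simp: subset_iff)
  qed
qed

text \<open>Vertices are picked in turn from \<open>F\<close>, \<open>G\<close>, \<open>H\<close>,
  each within the large sets left by its predecessors. In a triangle-free graph the three conditions
  therefore cannot hold together.\<close>

lemma eventually_no_triangle:
  assumes nontriv: "F \<noteq> bot" "G \<noteq> bot" "H \<noteq> bot"
    and ev: "eventually (\<lambda>x. eventually (\<lambda>z. E x z) G) F"
      "eventually (\<lambda>x. eventually (\<lambda>z. E x z) H) F" "eventually (\<lambda>x. eventually (\<lambda>z. E x z) H) G"
  shows "\<exists>x y z. E x y \<and> E y z \<and> E x z"
proof -
  obtain x where x: "eventually (\<lambda>z. E x z) G" "eventually (\<lambda>z. E x z) H"
    using eventually_happens[OF eventually_conj[OF ev(1,2)]] nontriv(1) by blast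
  obtain y where y: "E x y" "eventually (\<lambda>z. E y z) H"
    using eventually_happens[OF eventually_conj[OF x(1) ev(3)]] nontriv(2) by blast
  obtain z where "E x z" "E y z"
    using eventually_happens[OF eventually_conj[OF x(2) y(2)]] nontriv(3) by blast
  with y(1) show ?thesis by blast
qed

text \<open>For most bases \<open>b\<close> of rank \<open>j\<close>, \<open>P\<close> holds at
  \<open>b + \<omega> ^ j\<close> and at most points of rank \<open>i\<close> beneath it. An
  increasing sequence of such bases gives the limit points and the rows converging to them.\<close>

lemma closed_copy_if_two_ranks_large:
  assumes "i < j" "j < k" "0 < n"
    and P: "eventually P (points i (k - i) \<beta>)" "eventually P (points j (k - j) \<beta>)"
  shows "\<exists>X. closed_copy X (\<omega> * ord_of_nat n + 1) \<and> (\<forall>x\<in>X. P x)"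
proof -
  define Q where "Q b \<longleftrightarrow> P (b + \<omega> ^ j) \<and> eventually P (points i (j - i) b)" for b
  have "eventually P (points i ((j - i) + (k - j)) \<beta>)" using P(1) assms(1,2) by simp
  then have "eventually (\<lambda>b. eventually P (points i (j - i) b)) (bases (i + (j - i)) (k - j) \<beta>)"
    unfolding points_def eventually_filtermap eventually_bases_add .
  then have Q: "eventually Q (bases j (k - j) \<beta>)"
    using P(2) assms(1) unfolding points_def eventually_filtermap Q_def by (simp add: eventually_conj)
  have ex: "\<exists>b. Q b \<and> p < b + \<omega> ^ j \<and> b + \<omega> ^ j < \<beta> + \<omega> ^ k" if p: "p < \<beta> + \<omega> ^ k" for p
  proof -
    have "eventually (\<lambda>b. p < b + \<omega> ^ j \<and> b + \<omega> ^ j < \<beta> + \<omega> ^ k) (bases j (k - j) \<beta>)"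
      using points_near[of "k - j" p \<beta> j] p assms(2) unfolding points_def eventually_filtermap by simp
    then have "eventually (\<lambda>b. Q b \<and> p < b + \<omega> ^ j \<and> b + \<omega> ^ j < \<beta> + \<omega> ^ k) (bases j (k - j) \<beta>)"
      using Q by (simp add: eventually_conj)
    moreover have "bases j (k - j) \<beta> \<noteq> bot" using is_ultra_bases by (simp add: is_ultra_def)
    ultimately show ?thesis using eventually_happens by blast
  qed
  have "\<beta> < \<beta> + \<omega> ^ k" using plus_cord_strict_mono[OF omega_power_pos, of \<beta>] by simp
  have "\<exists>b. \<forall>l. (Q (b l) \<and> b l + \<omega> ^ j < \<beta> + \<omega> ^ k) \<and> b l + \<omega> ^ j < b (Suc l) + \<omega> ^ j"
    by (rule dependent_nat_choice) (use ex ex[OF \<open>\<beta> < \<beta> + \<omega> ^ k\<close>] in blast)+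
  then obtain b where b: "\<And>l. Q (b l)" "\<And>l. b l + \<omega> ^ j < b (Suc l) + \<omega> ^ j" by blast
  have b_mono: "b l + \<omega> ^ j < b m + \<omega> ^ j" if "l < m" for l m
    using lift_Suc_mono_less[of "\<lambda>l. b l + \<omega> ^ j"] b(2) that by blast
  \<comment> \<open>The graph is taken to be empty, as only membership in \<open>P\<close> is
    sought.\<close>
  have "\<exists>X. closed_copy X (\<omega> * ord_of_nat n + 1) \<and> (\<forall>x\<in>X. P x) \<and>
      (\<forall>x\<in>X. \<forall>z\<in>X. x \<noteq> z \<longrightarrow> \<not> False)"
  proof (rule independent_closed_copy[where F = "\<lambda>l. points i (j - i) (b l)" and y = "\<lambda>l. b l + \<omega> ^ j"])
    show "points i (j - i) (b l) \<noteq> bot" for l using is_ultra_points by (simp add: is_ultra_def)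
    show "0 < b l + \<omega> ^ j" for l
      using plus_cord_strict_mono[OF omega_power_pos, of "b l"] zero_le_cord by (metis add.right_neutral le_less_trans)
    show "eventually (\<lambda>x. p < x \<and> x < b l + \<omega> ^ j) (points i (j - i) (b l))" if "p < b l + \<omega> ^ j" for l p
      using points_near[of "j - i" p "b l" i] that assms(1) by simp
    show "eventually P (points i (j - i) (b l))" "P (b l + \<omega> ^ j)" for l
      using b(1) by (simp_all add: Q_def)
  qed (use assms(3) b_mono in simp_all)
  then show ?thesis by (elim exE conjE) (intro exI conjI)
qed

text \<open>A finite multiple of \<open>\<omega> ^ 4\<close> is obtained, which makes the bound
  \<open>\<omega> ^ 5\<close> strict.\<close>

lemma closed_arrow_omega_times:
  assumes n: "0 < n"
  shows "\<exists>N. closed_arrow (\<omega> ^ 4 * ord_of_nat N) (\<omega> * ord_of_nat n + 1) 3"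
proof -
  let ?K = "Pow {..<4 :: nat} \<times> Pow {..<4 :: nat} \<times> Pow {..<4 :: nat} \<times> Pow {..4 :: nat} \<times> Pow {..4 :: nat}"
  have "finite ?K" by simp
  \<comment> \<open>With \<open>n + 3\<close> indices there are three for the triangle argument and
    a later partner \<open>h (n + 2)\<close> for each \<open>h i\<close> with
    \<open>i < n\<close>.\<close>
  from ramsey_pairs[OF this, of "n + 3"]
  obtain N :: nat where N: "\<forall>f. (\<forall>a b. f a b \<in> ?K) \<longrightarrow> (\<exists>h c. (\<forall>i<n + 3. h i < N) \<and>
      (\<forall>i j. i < j \<and> j < n + 3 \<longrightarrow> h i < h j \<and> f (h i) (h j) = c))"
    by (elim exE) (rule that)
  \<comment> \<open>\<open>Suc N\<close> keeps every \<open>y a\<close> with \<open>a < N\<close>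
    strictly below \<open>\<gamma>\<close>.\<close>
  define \<gamma> where "\<gamma> = \<omega> ^ 4 * ord_of_nat (Suc N)"
  have "closed_arrow \<gamma> (\<omega> * ord_of_nat n + 1) 3" unfolding closed_arrow_def
  proof (intro ballI)
    fix c assume c: "c \<in> [{..<\<gamma>}]\<^bsup>2\<^esup> \<rightarrow> {0, 1 :: nat}"
    define E where "E x z \<longleftrightarrow> x < \<gamma> \<and> z < \<gamma> \<and> x \<noteq> z \<and> c {x, z} = 1" for x z
    have sym: "E z x" if "E x z" for x z using that by (auto simp: E_def insert_commute)
    have pairE: "\<exists>x z. e = {x, z} \<and> x \<in> X \<and> z \<in> X \<and> x \<noteq> z" if "e \<in> [X]\<^bsup>2\<^esup>" for e and X :: "cord set"
      using that by (auto simp: nsets_def card_2_iff)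
    show "\<exists>X\<subseteq>{..<\<gamma>}. closed_copy X (\<omega> * ord_of_nat n + 1) \<and> (\<forall>e\<in>[X]\<^bsup>2\<^esup>. c e = 0) \<or>
        closed_copy X 3 \<and> (\<forall>e\<in>[X]\<^bsup>2\<^esup>. c e = 1)" (is ?goal)
    proof (cases "\<exists>x y z. E x y \<and> E y z \<and> E x z")
      case True
      have "\<exists>x y z. x < y \<and> y < z \<and> E x y \<and> E y z \<and> E x z"
      proof -
        obtain x y z where "E x y" "E y z" "E x z" "E y x" "E z y" "E z x" "x \<noteq> y" "y \<noteq> z" "x \<noteq> z"
          using True sym by (metis E_def)
        then show ?thesis
          by (cases x y rule: linorder_cases; cases y z rule: linorder_cases; cases x z rule: linorder_cases) blast+
      qed
      then obtain x y z where xyz: "x < y" "y < z" "E x y" "E y z" "E x z" by blast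
      have "c e = 1" if "e \<in> [{x, y, z}]\<^bsup>2\<^esup>" for e
        using pairE[OF that] xyz(3-5) by (auto simp: E_def insert_commute)
      then show ?thesis using closed_copy_3[OF xyz(1,2)] xyz(3-5) by (intro exI[of _ "{x, y, z}"]) (auto simp: E_def)
    next
      case False
      have indep: ?goal if X: "closed_copy X (\<omega> * ord_of_nat n + 1)" "X \<subseteq> {..<\<gamma>}"
        "\<And>a b. a \<in> X \<Longrightarrow> b \<in> X \<Longrightarrow> a \<noteq> b \<Longrightarrow> \<not> E a b" for X
      proof -
        have "c e = 0" if e: "e \<in> [X]\<^bsup>2\<^esup>" for e
        proof -
          have "e \<in> [{..<\<gamma>}]\<^bsup>2\<^esup>" using e nsets_mono[OF X(2)] by blast
          then have "c e \<in> {0, 1}" using c by blast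
          moreover obtain x z where "e = {x, z}" "x \<in> X" "z \<in> X" "x \<noteq> z" using pairE[OF e] by blast
          then have "c e \<noteq> 1" using X(2) X(3)[of x z] by (auto simp: E_def)
          ultimately show ?thesis by blast
        qed
        then have "closed_copy X (\<omega> * ord_of_nat n + 1) \<and> (\<forall>e\<in>[X]\<^bsup>2\<^esup>. c e = 0)"
          using X(1) by blast
        with X(2) show ?thesis by (intro exI[of _ X] conjI disjI1) simp_all
      qed
      define y where "y a = \<omega> ^ 4 * ord_of_nat a + \<omega> ^ 4" for a
      define G where "G j a = points j (4 - j) (\<omega> ^ 4 * ord_of_nat a)" for j a
      define S where "S a b = {j. j < 4 \<and> eventually (E (y a)) (G j b)}" for a b
      \<comment> \<open>Rank 4 is included because \<open>G 4 a\<close> is principal at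
        \<open>y a\<close>: edges among the \<open>y a\<close> are then treated like edges between
        points of equal lower rank.\<close>
      define C where "C a b = {j. j \<le> 4 \<and> eventually (\<lambda>x. eventually (E x) (G j b)) (G j a)}" for a b
      have ultra: "is_ultra (G j a)" for j a unfolding G_def by (rule is_ultra_points)
      then have nontriv: "G j a \<noteq> bot" for j a by (simp add: is_ultra_def)
      have y_Suc: "y a = \<omega> ^ 4 * ord_of_nat (Suc a)" for a by (simp add: y_def times_cord_plus)
      have y_less: "y a < y b" if "a < b" for a b
        unfolding y_Suc using that by (intro times_cord_strict_mono omega_power_pos) (simp del: ord_of_nat.simps)
      have y_lt: "y a < \<gamma>" if "a < N" for a
        unfolding y_Suc \<gamma>_def using that by (intro times_cord_strict_mono omega_power_pos) (simp del: ord_of_nat.simps)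
      have G4: "eventually P (G 4 a) \<longleftrightarrow> P (y a)" for P a
        by (simp add: G_def points_def eventually_filtermap eventually_principal y_def)
      show ?goal
      proof (cases "\<exists>a b i j. i < j \<and> i \<in> S a b \<and> j \<in> S a b")
        case True
        then obtain a b i j where ij: "i < j" "i \<in> S a b" "j \<in> S a b" by blast
        \<comment> \<open>A copy inside the neighbourhood of \<open>y a\<close> is independent, as
          there is no triangle.\<close>
        have "\<exists>X. closed_copy X (\<omega> * ord_of_nat n + 1) \<and> (\<forall>x\<in>X. E (y a) x)"
          using ij n unfolding S_def G_def
          by (intro closed_copy_if_two_ranks_large[of i j 4 n "E (y a)" "\<omega> ^ 4 * ord_of_nat b"]) auto
        then obtain X where X: "closed_copy X (\<omega> * ord_of_nat n + 1)" "\<forall>x\<in>X. E (y a) x"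
          by (elim exE conjE) (rule that)
        show ?thesis using X(1)
        proof (rule indep)
          show "X \<subseteq> {..<\<gamma>}" using X(2) by (auto simp: E_def)
          show "\<not> E u v" if "u \<in> X" "v \<in> X" for u v
            using bspec[OF X(2) that(1)] bspec[OF X(2) that(2)] False by blast
        qed
      next
        case uniq: False
        have card1: "card (S a b) \<le> 1" for a b
        proof -
          have "finite (S a b)" by (simp add: S_def)
          moreover have "i = j" if "i \<in> S a b" "j \<in> S a b" for i j
            using uniq that by (metis linorder_neqE_nat)
          ultimately show ?thesis by (simp add: card_le_Suc0_iff_eq)
        qed
        \<comment> \<open>Both orders of the indices are recorded, since \<open>S\<close> and
          \<open>C\<close> need not be symmetric.\<close>
        define col where "col a b = (S a a, S a b, S b a, C a b, C b a)" for a b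
        have "\<forall>a b. col a b \<in> ?K" by (auto simp: col_def S_def C_def)
        from mp[OF spec[OF N] this] obtain h d where h: "\<forall>i<n + 3. h i < N"
            "\<forall>i j. i < j \<and> j < n + 3 \<longrightarrow> h i < h j \<and> col (h i) (h j) = d"
          by (elim exE conjE) (rule that)
        obtain d1 d2 d3 d4 d5 where d: "d = (d1, d2, d3, d4, d5)" by (cases d)
        have h_mono: "h i < h j" if "i < j" "j < n + 3" for i j using h(2) that by blast
        have hcol: "S (h i) (h i) = d1" "S (h i) (h j) = d2" "S (h j) (h i) = d3"
            "C (h i) (h j) = d4" "C (h j) (h i) = d5" if "i < j" "j < n + 3" for i j
          using h(2) that unfolding col_def d by blast+
        have d123: "card d1 \<le> 1" "card d2 \<le> 1" "card d3 \<le> 1"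
          using card1[of "h 0" "h 0"] card1[of "h 0" "h 1"] card1[of "h 1" "h 0"] hcol(1-3)[of 0 1] by simp_all
        \<comment> \<open>Three sets with at most one rank each cannot cover the ranks 0 to 3; here
          the exponent 4 enters.\<close>
        have "card (d1 \<union> d2 \<union> d3) \<le> 3"
          using card_Un_le[of "d1 \<union> d2" d3] card_Un_le[of d1 d2] d123 by linarith
        then have "\<not> {..<4} \<subseteq> d1 \<union> d2 \<union> d3"
        proof -
          have "finite (d1 \<union> d2 \<union> d3)"
            using hcol(1-3)[of 0 1] by (auto simp: S_def)
          then show ?thesis using card_mono[of "d1 \<union> d2 \<union> d3" "{..<4}"] \<open>card (d1 \<union> d2 \<union> d3) \<le> 3\<close> by force
        qed
        then obtain j where j: "j < 4" "j \<notin> d1" "j \<notin> d2" "j \<notin> d3" by auto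
        have noS: "j \<notin> S (h i) (h l)" if "i < n" "l < n" for i l
          using hcol(1)[of i "n + 2"] hcol(2)[of i l] hcol(3)[of l i] j that
          by (cases i l rule: linorder_cases) auto
        have tri: "\<not> (k \<in> C a b \<and> k \<in> C a b' \<and> k \<in> C b b')" for k a b b'
          using eventually_no_triangle[OF nontriv nontriv nontriv, of E k b k a k b'] False
          unfolding C_def by blast
        \<comment> \<open>By homogeneity, a rank in \<open>d4\<close> or \<open>d5\<close> would
          mostly join three filters pairwise, in increasing or decreasing order of the indices, and
          so yield a triangle.\<close>
        have "k \<notin> d4" "k \<notin> d5" for k
          using tri[of k "h 0" "h 1" "h 2"] tri[of k "h 2" "h 1" "h 0"]
            hcol(4,5)[of 0 1] hcol(4,5)[of 0 2] hcol(4,5)[of 1 2] by auto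
        moreover have "k \<notin> C a a" for k a using tri by blast
        ultimately have noC: "k \<notin> C (h i) (h l)" if "i < n" "l < n" for k i l
          using hcol(4)[of i l] hcol(5)[of l i] that by (cases i l rule: linorder_cases) auto
        have "\<exists>X. closed_copy X (\<omega> * ord_of_nat n + 1) \<and> (\<forall>x\<in>X. x < \<gamma>) \<and>
            (\<forall>a\<in>X. \<forall>b\<in>X. a \<noteq> b \<longrightarrow> \<not> E a b)"
        proof (rule independent_closed_copy[where F = "\<lambda>i. G j (h i)" and y = "\<lambda>i. y (h i)"])
          fix i l assume i: "i < n"
          have near: "eventually (\<lambda>x. p < x \<and> x < y (h i)) (G j (h i))" if "p < y (h i)" for p
            using points_near[of "4 - j" p "\<omega> ^ 4 * ord_of_nat (h i)" j] j(1) that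
            by (simp add: G_def y_def)
          then show "eventually (\<lambda>x. p < x \<and> x < y (h i)) (G j (h i))" if "p < y (h i)" for p
            using that .
          show "G j (h i) \<noteq> bot" by (rule nontriv)
          show pos: "0 < y (h i)"
            unfolding y_Suc using times_cord_strict_mono[OF omega_power_pos, of 0 "ord_of_nat (Suc (h i))" 4]
            using ord_of_nat_less_iff[of 0 "Suc (h i)"] by (simp add: times_cord_zero)
          show yg: "y (h i) < \<gamma>" using h(1) i by (intro y_lt) simp
          show "eventually (\<lambda>x. x < \<gamma>) (G j (h i))"
            using near[OF pos] yg by (auto elim!: eventually_mono)
          assume l: "l < n"
          show "\<not> E (y (h i)) (y (h l))" using noC[OF i l, of 4] by (simp add: C_def G4)
          show "eventually (\<lambda>x. \<not> E (y (h i)) x) (G j (h l))"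
            using noS[OF i l] j(1) by (intro is_ultra_not_eventually[OF ultra]) (auto simp: S_def)
          have "\<not> eventually (\<lambda>x. eventually (E x) (G j (h l))) (G j (h i))"
            using noC[OF i l, of j] j(1) by (auto simp: C_def)
          then have "eventually (\<lambda>x. \<not> eventually (E x) (G j (h l))) (G j (h i))"
            by (rule is_ultra_not_eventually[OF ultra])
          then show "eventually (\<lambda>x. eventually (\<lambda>z. \<not> E x z) (G j (h l))) (G j (h i))"
            by (rule eventually_mono) (rule is_ultra_not_eventually[OF ultra])
        qed (use n sym h_mono y_less in auto)
        then obtain X where X: "closed_copy X (\<omega> * ord_of_nat n + 1)" "\<forall>x\<in>X. x < \<gamma>"
          "\<forall>a\<in>X. \<forall>b\<in>X. a \<noteq> b \<longrightarrow> \<not> E a b" by (elim exE conjE) (rule that)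
        show ?thesis by (rule indep[OF X(1)]) (use X(2,3) in auto)
      qed
    qed
  qed
  then show ?thesis unfolding \<gamma>_def by blast
qed

theorem theorem1p1:
  shows "((\<exists>\<gamma>. closed_arrow \<gamma> (\<omega> * 2 + 1) 3) \<and>
          \<omega> ^ 4 < closed_Ramsey (\<omega> * 2 + 1) 3 \<and>
          closed_Ramsey (\<omega> * 2 + 1) 3 < \<omega> ^ 5) \<and>
         (\<forall>n::nat. 3 \<le> n \<longrightarrow>
            (\<exists>\<gamma>. closed_arrow \<gamma> (\<omega> * ord_of_nat n + 1) 3) \<and>
            \<omega> ^ 4 * ord_of_nat (n - 2) + 1 < closed_Ramsey (\<omega> * ord_of_nat n + 1) 3 \<and>
            closed_Ramsey (\<omega> * ord_of_nat n + 1) 3 < \<omega> ^ 5)"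
proof -
  have bounds: "(\<exists>\<gamma>. closed_arrow \<gamma> (\<omega> * ord_of_nat n + 1) 3) \<and>
      \<delta> < closed_Ramsey (\<omega> * ord_of_nat n + 1) 3 \<and> closed_Ramsey (\<omega> * ord_of_nat n + 1) 3 < \<omega> ^ 5"
    if "0 < n" and neg: "\<not> closed_arrow \<delta> (\<omega> * ord_of_nat n + 1) 3" for n \<delta>
  proof -
    obtain N where N: "closed_arrow (\<omega> ^ 4 * ord_of_nat N) (\<omega> * ord_of_nat n + 1) 3"
      using closed_arrow_omega_times[OF \<open>0 < n\<close>] ..
    have "\<omega> ^ 4 * ord_of_nat N < \<omega> ^ 4 * \<omega>"
      by (intro times_cord_strict_mono omega_power_pos ord_of_nat_less_omega)
    also have "\<omega> ^ 4 * \<omega> = \<omega> ^ 5" using power_Suc2[of \<omega> 4] by simp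
    finally have "closed_Ramsey (\<omega> * ord_of_nat n + 1) 3 < \<omega> ^ 5"
      using closed_Ramsey_bounds(2)[OF N neg] by (rule le_less_trans[rotated])
    then show ?thesis using N closed_Ramsey_bounds(1)[OF N neg] by blast
  qed
  have two: "(2 :: cord) = ord_of_nat 2" by (simp only: ord_of_nat_numeral)
  have "\<not> closed_arrow (\<omega> ^ 4) (\<omega> * ord_of_nat 2 + 1) 3"
    using not_closed_arrow_omega_4 unfolding two .
  from bounds[OF _ this] have "(\<exists>\<gamma>. closed_arrow \<gamma> (\<omega> * 2 + 1) 3) \<and>
      \<omega> ^ 4 < closed_Ramsey (\<omega> * 2 + 1) 3 \<and> closed_Ramsey (\<omega> * 2 + 1) 3 < \<omega> ^ 5"
    unfolding two by simp
  moreover have "(\<exists>\<gamma>. closed_arrow \<gamma> (\<omega> * ord_of_nat n + 1) 3) \<and>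
      \<omega> ^ 4 * ord_of_nat (n - 2) + 1 < closed_Ramsey (\<omega> * ord_of_nat n + 1) 3 \<and>
      closed_Ramsey (\<omega> * ord_of_nat n + 1) 3 < \<omega> ^ 5" if "3 \<le> n" for n
    using that by (intro bounds not_closed_arrow_omega_4_times) auto
  ultimately show ?thesis by blast
qed

end
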